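(* Let $\mathcal{M}$ be the set of maximizers of $\xi$ over $\{(z_1,z_2): z_1\ge 0,\ z_1+c\le z_2<\infty\}$. Then $\mathcal{M}\neq\emptyset$ and, for every $(z_1,z_2)\in\mathcal{M}$, $$\frac{z_2-z_1-c}{Z^{(q)}(z_2)-Z^{(q)}(z_1)}-\phi\frac{\overline{Z}^{(q)}(z_2)-\overline{Z}^{(q)}(z_1)}{Z^{(q)}(z_2)-Z^{(q)}(z_1)}=\frac{1-\phi Z^{(q)}(z_2)}{qW^{(q)}(z_2)}.$$
   Context: $X$ is a spectrally negative L\'evy process (no positive jumps), neither a pure increasing linear drift nor the negative of a subordinator, with Laplace exponent $\psi(\theta)=\ln\mathrm{E}_0[e^{\theta X(1)}]=\gamma\theta+\frac12\sigma^2\theta^2-\int_{(0,\infty)}(1-e^{-\theta x}-\theta x\mathbf{1}_{(0,1)}(x))\upsilon(\mathrm{d}x)$, where $\int_{(0,\infty)}(1\wedge x^2)\upsilon(\mathrm{d}x)<\infty$, and it is assumed that $\psi'(0+)>-\infty$. Constants: $q>0$, $c>0$, $\phi>1$. $W^{(q)}:[0,\infty)\to[0,\infty)$ is the unique strictly increasing continuous function with $\int_0^\infty e^{-\theta x}W^{(q)}(x)\mathrm{d}x=1/(\psi(\theta)-q)$ for $\theta>\Phi_q$, where $\Phi_q$ is the largest root of $\psi(\theta)=q$. Put $Z^{(q)}(x)=1+q\int_0^xW^{(q)}(z)\mathrm{d}z$ and $\overline{Z}^{(q)}(x)=\int_0^xZ^{(q)}(z)\mathrm{d}z$. For $z_1\ge0$,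 $z_1+c\le z_2<\infty$, $$\xi(z_1,z_2)=\frac{z_2-z_1-c}{Z^{(q)}(z_2)-Z^{(q)}(z_1)}-\phi\frac{\overline{Z}^{(q)}(z_2)-\overline{Z}^{(q)}(z_1)}{Z^{(q)}(z_2)-Z^{(q)}(z_1)}.$$ *)

theory Defs
  imports "HOL-Probability.Probability"
begin

definition cadlag :: "(real \<Rightarrow> real) \<Rightarrow> bool" where
  "cadlag f \<longleftrightarrow>
     (\<forall>t\<ge>0. continuous (at_right t) f) \<and> (\<forall>t>0. \<exists>l. (f \<longlongrightarrow> l) (at_left t))"

text \<open>Real-valued processes have time set \<open>[0,\<infinity>)\<close>; values at negative times are irrelevant.
  The process starts at 0, so \<open>M\<close> plays the role of \<open>P\<^sub>0\<close>.\<close>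

definition levy_process :: "'a measure \<Rightarrow> (real \<Rightarrow> 'a \<Rightarrow> real) \<Rightarrow> bool" where
  "levy_process M X \<longleftrightarrow>
     prob_space M \<and>
     (\<forall>t\<ge>0. X t \<in> borel_measurable M) \<and>
     (AE \<omega> in M. X 0 \<omega> = 0) \<and>
     (AE \<omega> in M. cadlag (\<lambda>t. X t \<omega>)) \<and>
     (\<forall>(n::nat) (t::nat \<Rightarrow> real). 0 \<le> t 0 \<and> mono t \<longrightarrow>
        prob_space.indep_vars M (\<lambda>_. borel)
          (\<lambda>i \<omega>. X (t (Suc i)) \<omega> - X (t i) \<omega>) {..<n}) \<and>
     (\<forall>s\<ge>0. \<forall>t\<ge>0.
        distr M borel (\<lambda>\<omega>. X (s + t) \<omega> - X s \<omega>) = distr M borel (X t))"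

definition no_positive_jumps :: "'a measure \<Rightarrow> (real \<Rightarrow> 'a \<Rightarrow> real) \<Rightarrow> bool" where
  "no_positive_jumps M X \<longleftrightarrow>
     (AE \<omega> in M. \<forall>t>0. \<forall>l. ((\<lambda>s. X s \<omega>) \<longlongrightarrow> l) (at_left t) \<longrightarrow> X t \<omega> \<le> l)"

definition subordinator :: "'a measure \<Rightarrow> (real \<Rightarrow> 'a \<Rightarrow> real) \<Rightarrow> bool" where
  "subordinator M Y \<longleftrightarrow> levy_process M Y \<and> (AE \<omega> in M. mono_on {0..} (\<lambda>t. Y t \<omega>))"

definition increasing_linear_drift :: "'a measure \<Rightarrow> (real \<Rightarrow> 'a \<Rightarrow> real) \<Rightarrow> bool" where
  "increasing_linear_drift M X \<longleftrightarrow> (\<exists>d>0. AE \<omega> in M. \<forall>t\<ge>0. X t \<omega> = d * t)"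

definition spectrally_negative_levy :: "'a measure \<Rightarrow> (real \<Rightarrow> 'a \<Rightarrow> real) \<Rightarrow> bool" where
  "spectrally_negative_levy M X \<longleftrightarrow>
     levy_process M X \<and> no_positive_jumps M X \<and>
     \<not> increasing_linear_drift M X \<and> \<not> subordinator M (\<lambda>t \<omega>. - X t \<omega>)"

definition laplace_exponent :: "'a measure \<Rightarrow> (real \<Rightarrow> 'a \<Rightarrow> real) \<Rightarrow> real \<Rightarrow> real" where
  "laplace_exponent M X \<theta> = ln (\<integral>\<omega>. exp (\<theta> * X 1 \<omega>) \<partial>M)"

text \<open>A measure on \<open>(0,\<infinity>)\<close> is represented by a Borel measure on the line that does not
  charge \<open>(-\<infinity>,0]\<close>.\<close>

definition levy_measure :: "real measure \<Rightarrow> bool" where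
  "levy_measure \<upsilon> \<longleftrightarrow>
     sets \<upsilon> = sets borel \<and> emeasure \<upsilon> {..0} = 0 \<and>
     (\<integral>\<^sup>+x\<in>{0<..}. ennreal (min 1 (x\<^sup>2)) \<partial>\<upsilon>) < \<infinity>"

text \<open>Exponential moments of \<open>X 1\<close> of nonnegative order are finite for every spectrally negative
  Levy process.  This is spelled out because the Bochner integral in
  \<^const>\<open>laplace_exponent\<close> is 0 when the integrand is not integrable.\<close>

definition has_levy_triplet ::
    "'a measure \<Rightarrow> (real \<Rightarrow> 'a \<Rightarrow> real) \<Rightarrow> real \<Rightarrow> real \<Rightarrow> real measure \<Rightarrow> bool" where
  "has_levy_triplet M X \<gamma> \<sigma> \<upsilon> \<longleftrightarrow>
     levy_measure \<upsilon> \<and>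
     (\<forall>\<theta>\<ge>0. integrable M (\<lambda>\<omega>. exp (\<theta> * X 1 \<omega>)) \<and>
        laplace_exponent M X \<theta> =
          \<gamma> * \<theta> + 1/2 * \<sigma>\<^sup>2 * \<theta>\<^sup>2
          - (LINT x:{0<..}|\<upsilon>. 1 - exp (- \<theta> * x) - \<theta> * x * indicator {0<..<1} x))"

text \<open>Finiteness of \<open>\<psi>'(0+)\<close>.  As \<open>\<psi>\<close> is convex, \<open>\<psi>'\<close> is monotone on \<open>(0,\<infinity>)\<close> and the limit
  always exists in \<open>[-\<infinity>,\<infinity>)\<close>, so this says exactly \<open>\<psi>'(0+) > -\<infinity>\<close>.\<close>

definition finite_deriv_at_0 :: "(real \<Rightarrow> real) \<Rightarrow> bool" where
  "finite_deriv_at_0 \<psi> \<longleftrightarrow> (\<exists>l. (deriv \<psi> \<longlongrightarrow> l) (at_right 0))"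

definition largest_root :: "(real \<Rightarrow> real) \<Rightarrow> real \<Rightarrow> real" where
  "largest_root \<psi> q = (GREATEST \<theta>. 0 \<le> \<theta> \<and> \<psi> \<theta> = q)"

text \<open>Scale functions are only constrained on \<open>[0,\<infinity>)\<close>, where they are uniquely determined.\<close>

definition scale_function :: "(real \<Rightarrow> real) \<Rightarrow> real \<Rightarrow> (real \<Rightarrow> real) \<Rightarrow> bool" where
  "scale_function \<psi> q W \<longleftrightarrow>
     (\<forall>x\<ge>0. 0 \<le> W x) \<and> strict_mono_on {0..} W \<and> continuous_on {0..} W \<and>
     (\<forall>\<theta>>largest_root \<psi> q.
        ((\<lambda>x. exp (- \<theta> * x) * W x) has_integral 1 / (\<psi> \<theta> - q)) {0..})"

definition Z :: "real \<Rightarrow> (real \<Rightarrow> real) \<Rightarrow> real \<Rightarrow> real" where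
  "Z q W x = 1 + q * integral {0..x} W"

definition Zbar :: "real \<Rightarrow> (real \<Rightarrow> real) \<Rightarrow> real \<Rightarrow> real" where
  "Zbar q W x = integral {0..x} (Z q W)"

definition xi :: "real \<Rightarrow> real \<Rightarrow> real \<Rightarrow> (real \<Rightarrow> real) \<Rightarrow> real \<Rightarrow> real \<Rightarrow> real" where
  "xi q c \<phi> W z1 z2 =
     (z2 - z1 - c) / (Z q W z2 - Z q W z1)
     - \<phi> * ((Zbar q W z2 - Zbar q W z1) / (Z q W z2 - Z q W z1))"

definition xi_domain :: "real \<Rightarrow> (real \<times> real) set" where
  "xi_domain c = {(z1, z2). 0 \<le> z1 \<and> z1 + c \<le> z2}"

definition xi_maximizers :: "real \<Rightarrow> real \<Rightarrow> real \<Rightarrow> (real \<Rightarrow> real) \<Rightarrow> (real \<times> real) set" where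
  "xi_maximizers q c \<phi> W =
     {z. is_arg_max (\<lambda>(z1, z2). xi q c \<phi> W z1 z2) (\<lambda>z. z \<in> xi_domain c) z}"

end

theory Submission
  imports Defs
begin

text \<open>Maximizing \<open>\<xi>\<close> amounts to studying, for a multiplier \<open>m\<close>, the function
  \<open>g\<^sub>m z = z - \<phi> Zbar z - m Z z\<close>: one has \<open>\<xi> z\<^sub>1 z\<^sub>2 \<ge> m\<close> iff \<open>g\<^sub>m z\<^sub>2 - g\<^sub>m z\<^sub>1 \<ge> c\<close>, so at a maximizer with
  value \<open>m\<close> the point \<open>z\<^sub>2\<close> maximizes \<open>g\<^sub>m\<close> on \<open>[z\<^sub>1 + c, \<infinity>)\<close>, and the claim is \<open>g\<^sub>m' z\<^sub>2 = 0\<close>.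
  Everything rests on two properties of the scale function, where \<open>\<Phi>\<close> is the largest root of
  \<open>\<psi> = q\<close>: \<open>exp (- \<Phi> x) W x\<close> is nondecreasing, and \<open>H = Z - (q / \<Phi>) W\<close> decreases to 0.
  They make \<open>Z / W\<close> nonincreasing, which excludes boundary maximizers, and they show that \<open>\<xi>\<close> exceeds
  somewhere its limit \<open>- \<phi> / \<Phi>\<close> at infinity, so that a maximizer exists.

  Both properties are read off the Laplace transforms. The difference quotient of \<open>\<psi>\<close> at \<open>\<Phi>\<close> is
  a Bernstein function, so the transforms in question are completely monotone, which by
  Hausdorff's moment argument (Bernstein polynomials) forces a continuous original to be nonnegative.
  Complete monotonicity is used only through iterated differences along arithmetic progressions;
  this avoids differentiating under integrals, and progressions can be chosen to miss \<open>\<Phi>\<close>.\<close>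

subsection \<open>Totally monotone sequences\<close>

text \<open>The depth argument truncates Hausdorff's condition to differences of order at most
  \<open>n\<close>, so that closure properties can be proved by induction on \<open>n\<close>. The
  backward difference is used, which removes the alternating signs.\<close>

primrec alternating :: "nat \<Rightarrow> (nat \<Rightarrow> real) \<Rightarrow> bool" where
  "alternating 0 a \<longleftrightarrow> (\<forall>k. 0 \<le> a k)"
| "alternating (Suc n) a \<longleftrightarrow> (\<forall>k. 0 \<le> a k) \<and> alternating n (\<lambda>k. a k - a (Suc k))"

definition totally_monotone :: "(nat \<Rightarrow> real) \<Rightarrow> bool" where
  "totally_monotone a \<longleftrightarrow> (\<forall>n. alternating n a)"

lemma alternating_nonneg: "alternating n a \<Longrightarrow> 0 \<le> a k"
  by (cases n) auto

lemma alternating_Suc_imp: "alternating (Suc n) a \<Longrightarrow> alternating n a"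
proof (induction n arbitrary: a)
  case (Suc n)
  then show ?case by (metis alternating.simps(2))
qed simp

lemma alternating_shift: "alternating n a \<Longrightarrow> alternating n (\<lambda>k. a (Suc k))"
  by (induction n arbitrary: a) auto

lemma alternating_add: "alternating n a \<Longrightarrow> alternating n b \<Longrightarrow> alternating n (\<lambda>k. a k + b k)"
proof (induction n arbitrary: a b)
  case (Suc n)
  have "alternating n (\<lambda>k. (a k - a (Suc k)) + (b k - b (Suc k)))"
    using Suc by simp
  then have "alternating n (\<lambda>k. a k + b k - (a (Suc k) + b (Suc k)))"
    by (simp add: algebra_simps)
  then show ?case using Suc.prems by simp
qed simp

text \<open>Discrete Leibniz rule: the difference of a product is
  \<open>(a k - a (Suc k)) * b k + a (Suc k) * (b k - b (Suc k))\<close>, a sum of products of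
  smaller depth.\<close>

lemma alternating_mult: "alternating n a \<Longrightarrow> alternating n b \<Longrightarrow> alternating n (\<lambda>k. a k * b k)"
proof (induction n arbitrary: a b)
  case (Suc n)
  have "alternating n (\<lambda>k. (a k - a (Suc k)) * b k)"
    using Suc alternating_Suc_imp[of n b] by simp
  moreover have "alternating n (\<lambda>k. a (Suc k) * (b k - b (Suc k)))"
    using Suc alternating_Suc_imp[of n a] by (intro Suc.IH alternating_shift) simp_all
  ultimately have "alternating n (\<lambda>k. (a k - a (Suc k)) * b k + a (Suc k) * (b k - b (Suc k)))"
    by (rule alternating_add)
  then have "alternating n (\<lambda>k. a k * b k - a (Suc k) * b (Suc k))"
    by (simp add: algebra_simps)
  then show ?case using Suc.prems by simp
qed simp

lemma totally_monotone_nonneg: "totally_monotone a \<Longrightarrow> 0 \<le> a k"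
  unfolding totally_monotone_def using alternating_nonneg by blast

lemma totally_monotone_diff: "totally_monotone a \<Longrightarrow> totally_monotone (\<lambda>k. a k - a (Suc k))"
  unfolding totally_monotone_def by (metis alternating.simps(2))

lemma totally_monotone_const: "0 \<le> c \<Longrightarrow> totally_monotone (\<lambda>_. c)"
proof -
  have "0 \<le> c \<Longrightarrow> alternating n (\<lambda>_. c)" for n and c :: real
    by (induction n arbitrary: c) simp_all
  then show "0 \<le> c \<Longrightarrow> ?thesis" by (simp add: totally_monotone_def)
qed

lemma totally_monotone_add:
  "totally_monotone a \<Longrightarrow> totally_monotone b \<Longrightarrow> totally_monotone (\<lambda>k. a k + b k)"
  by (simp add: totally_monotone_def alternating_add)

lemma totally_monotone_mult:
  "totally_monotone a \<Longrightarrow> totally_monotone b \<Longrightarrow> totally_monotone (\<lambda>k. a k * b k)"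
  by (simp add: totally_monotone_def alternating_mult)

text \<open>Discrete form of the fact that the reciprocal of a positive Bernstein function is
  completely monotone. A difference of reciprocals is the increment of \<open>a\<close> times two
  reciprocals, so depth \<open>n\<close> for \<open>1 / a\<close> yields depth
  \<open>Suc n\<close>.\<close>

lemma totally_monotone_inverse:
  assumes pos: "\<And>k. 0 < a k" and inc: "totally_monotone (\<lambda>k. a (Suc k) - a k)"
  shows "totally_monotone (\<lambda>k. 1 / a k)"
proof -
  have "alternating n (\<lambda>k. 1 / a k)" for n
  proof (induction n)
    case 0
    show ?case using pos by (simp add: less_imp_le)
  next
    case (Suc n)
    have "alternating n (\<lambda>k. a (Suc k) - a k)"
      using inc by (simp add: totally_monotone_def)
    then have "alternating n (\<lambda>k. ((a (Suc k) - a k) * (1 / a k)) * (1 / a (Suc k)))"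
      using Suc.IH alternating_shift[OF Suc.IH] by (intro alternating_mult)
    also have "(\<lambda>k. ((a (Suc k) - a k) * (1 / a k)) * (1 / a (Suc k))) = (\<lambda>k. 1 / a k - 1 / a (Suc k))"
    proof
      fix k
      show "((a (Suc k) - a k) * (1 / a k)) * (1 / a (Suc k)) = 1 / a k - 1 / a (Suc k)"
        using pos[of k] pos[of "Suc k"] by (simp add: field_simps)
    qed
    finally show ?case using pos by (simp add: less_imp_le)
  qed
  then show ?thesis by (simp add: totally_monotone_def)
qed

text \<open>Each difference only multiplies \<open>C\<close> by \<open>1 - exp (- (h * y))\<close>,
  which is nonnegative.\<close>

lemma totally_monotone_exp:
  assumes "0 \<le> C" "0 \<le> y" "0 \<le> h"
  shows "totally_monotone (\<lambda>k. C * exp (- ((s + real k * h) * y)))"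
proof -
  have "0 \<le> C \<Longrightarrow> alternating n (\<lambda>k. C * exp (- ((s + real k * h) * y)))" for n C
  proof (induction n arbitrary: C)
    case (Suc n)
    have "0 \<le> C * (1 - exp (- (h * y)))"
      using Suc.prems assms by simp
    from Suc.IH[OF this]
    have "alternating n (\<lambda>k. C * exp (- ((s + real k * h) * y)) - C * exp (- ((s + real (Suc k) * h) * y)))"
      by (simp add: algebra_simps exp_add exp_diff exp_minus divide_inverse)
    then show ?case using Suc.prems by simp
  qed simp
  then show ?thesis using assms by (simp add: totally_monotone_def)
qed

lemma totally_monotone_integral:
  assumes tm: "\<And>x. x \<in> space M \<Longrightarrow> totally_monotone (\<lambda>k. a k x)"
    and int: "\<And>k. integrable M (a k)"
  shows "totally_monotone (\<lambda>k. \<integral>x. a k x \<partial>M)"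
proof -
  have "(\<forall>x\<in>space M. alternating n (\<lambda>k. a k x)) \<Longrightarrow> (\<forall>k. integrable M (a k)) \<Longrightarrow>
      alternating n (\<lambda>k. \<integral>x. a k x \<partial>M)" for n
  proof (induction n arbitrary: a)
    case 0
    then show ?case by (auto intro!: Bochner_Integration.integral_nonneg)
  next
    case (Suc n)
    have "alternating n (\<lambda>k. \<integral>x. a k x - a (Suc k) x \<partial>M)"
      using Suc.prems by (intro Suc.IH) auto
    moreover have "0 \<le> (\<integral>x. a k x \<partial>M)" for k
      using Suc.prems by (auto intro!: Bochner_Integration.integral_nonneg)
    ultimately show ?case using Suc.prems by simp
  qed
  then show ?thesis using assms by (simp add: totally_monotone_def)
qed

section \<open>Hausdorff's moment argument\<close>

text \<open>A difference of consecutive moments inserts a factor \<open>1 - u x\<close> under the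
  integral, so \<open>j\<close> of them produce the integrand of a Bernstein polynomial.\<close>

lemma moments_iterated_difference:
  fixes g u :: "real \<Rightarrow> real"
  assumes int: "\<And>k. (\<lambda>x. u x ^ k * g x) absolutely_integrable_on S"
    and tm: "totally_monotone (\<lambda>k. integral S (\<lambda>x. u x ^ k * g x))"
  shows "(\<lambda>x. u x ^ k * (1 - u x) ^ j * g x) absolutely_integrable_on S"
    and "0 \<le> integral S (\<lambda>x. u x ^ k * (1 - u x) ^ j * g x)"
proof -
  have "(\<forall>k. (\<lambda>x. u x ^ k * (1 - u x) ^ j * g x) absolutely_integrable_on S) \<and>
     totally_monotone (\<lambda>k. integral S (\<lambda>x. u x ^ k * (1 - u x) ^ j * g x))"
  proof (induction j)
    case 0
    then show ?case using assms by simp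
  next
    case (Suc j)
    have eq: "(\<lambda>x. u x ^ k * (1 - u x) ^ Suc j * g x) =
      (\<lambda>x. u x ^ k * (1 - u x) ^ j * g x - u x ^ Suc k * (1 - u x) ^ j * g x)" for k
      by (auto simp: algebra_simps)
    have "integral S (\<lambda>x. u x ^ k * (1 - u x) ^ j * g x - u x ^ Suc k * (1 - u x) ^ j * g x) =
      integral S (\<lambda>x. u x ^ k * (1 - u x) ^ j * g x) - integral S (\<lambda>x. u x ^ Suc k * (1 - u x) ^ j * g x)" for k
      using Suc by (intro Henstock_Kurzweil_Integration.integral_diff set_lebesgue_integral_eq_integral(1)) blast+
    moreover have "totally_monotone (\<lambda>k. integral S (\<lambda>x. u x ^ k * (1 - u x) ^ j * g x) - integral S (\<lambda>x. u x ^ Suc k * (1 - u x) ^ j * g x))"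
      using Suc by (intro totally_monotone_diff) blast
    moreover have "(\<lambda>x. u x ^ k * (1 - u x) ^ j * g x - u x ^ Suc k * (1 - u x) ^ j * g x) absolutely_integrable_on S" for k
      using Suc by (intro set_integral_diff(1)) blast+
    ultimately show ?case unfolding eq by simp
  qed
  then show "(\<lambda>x. u x ^ k * (1 - u x) ^ j * g x) absolutely_integrable_on S"
    "0 \<le> integral S (\<lambda>x. u x ^ k * (1 - u x) ^ j * g x)"
    using totally_monotone_nonneg by blast+
qed

text \<open>The Bernstein polynomials of a nonnegative \<open>P\<close> have nonnegative
  coefficients, hence nonnegative integrals against \<open>g\<close>; they converge uniformly to
  \<open>P\<close>, and \<open>g\<close> is absolutely integrable.\<close>

lemma moments_positive_functional:
  fixes g u P :: "real \<Rightarrow> real"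
  assumes int: "\<And>k. (\<lambda>x. u x ^ k * g x) absolutely_integrable_on S"
    and tm: "totally_monotone (\<lambda>k. integral S (\<lambda>x. u x ^ k * g x))"
    and u: "\<And>x. x \<in> S \<Longrightarrow> u x \<in> {0..1}"
    and P: "continuous_on {0..1} P" "\<And>t. t \<in> {0..1} \<Longrightarrow> 0 \<le> P t"
    and intP: "(\<lambda>x. P (u x) * g x) integrable_on S"
  shows "0 \<le> integral S (\<lambda>x. P (u x) * g x)"
proof (rule field_le_epsilon)
  fix e :: real assume e: "e > 0"
  define K where "K = integral S (\<lambda>x. \<bar>g x\<bar>)"
  have g: "g absolutely_integrable_on S" using int[of 0] by simp
  then have gn: "(\<lambda>x. \<bar>g x\<bar>) integrable_on S"
    by (simp add: absolutely_integrable_on_def)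
  have K: "0 \<le> K" unfolding K_def using gn by (intro Henstock_Kurzweil_Integration.integral_nonneg) auto
  \<comment> \<open>A uniform error \<open>e / (K + 1)\<close> costs at most \<open>e\<close> after
    integration against \<open>g\<close>, whose L1 norm is \<open>K\<close>; adding 1 covers
    \<open>K = 0\<close>.\<close>
  have "e / (K + 1) > 0" using e K by simp
  from Bernstein_Weierstrass[OF P(1) this] obtain n where
    n: "\<And>t. t \<in> {0..1} \<Longrightarrow> \<bar>P t - (\<Sum>k\<le>n. P (k/n) * Bernstein n k t)\<bar> < e / (K + 1)"
    by blast
  define Q where "Q x = (\<Sum>k\<le>n. P (k/n) * Bernstein n k (u x)) * g x" for x
  have Qeq: "Q = (\<lambda>x. \<Sum>k\<le>n. (P (k/n) * (n choose k)) * (u x ^ k * (1 - u x) ^ (n - k) * g x))"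
    by (auto simp: Q_def Bernstein_def sum_distrib_right sum_distrib_left mult_ac)
  have bint: "(\<lambda>x. u x ^ k * (1 - u x) ^ j * g x) integrable_on S" for k j
    using moments_iterated_difference(1)[OF int tm] by (rule set_lebesgue_integral_eq_integral(1))
  have Qint: "Q integrable_on S"
    unfolding Qeq by (intro integrable_sum integrable_on_mult_right bint) auto
  have "integral S Q = (\<Sum>k\<le>n. (P (k/n) * (n choose k)) * integral S (\<lambda>x. u x ^ k * (1 - u x) ^ (n - k) * g x))"
    unfolding Qeq
    by (subst integral_sum) (auto intro!: integrable_on_mult_right bint)
  also have "\<dots> \<ge> 0"
  proof (intro sum_nonneg mult_nonneg_nonneg)
    fix k assume "k \<in> {..n}"
    \<comment> \<open>For \<open>n = 0\<close> the quotient is \<open>0 / 0 = 0\<close>, which still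
      lies in the unit interval.\<close>
    then have "real k / real n \<in> {0..1}" by (cases "n = 0") auto
    then show "0 \<le> P (real k / real n)" by (rule P(2))
  qed (use moments_iterated_difference(2)[OF int tm] in auto)
  finally have Q0: "0 \<le> integral S Q" .
  have "norm (integral S (\<lambda>x. P (u x) * g x - Q x)) \<le> integral S (\<lambda>x. e / (K + 1) * \<bar>g x\<bar>)"
  proof (intro Henstock_Kurzweil_Integration.integral_norm_bound_integral)
    show "(\<lambda>x. P (u x) * g x - Q x) integrable_on S"
      using intP Qint by (rule integrable_diff)
    show "(\<lambda>x. e / (K + 1) * \<bar>g x\<bar>) integrable_on S" using gn by (rule integrable_on_mult_right)
    fix x assume "x \<in> S"
    then have "\<bar>P (u x) - (\<Sum>k\<le>n. P (k/n) * Bernstein n k (u x))\<bar> * \<bar>g x\<bar> \<le> e / (K + 1) * \<bar>g x\<bar>"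
      using n[OF u[of x]] by (intro mult_right_mono) auto
    then show "norm (P (u x) * g x - Q x) \<le> e / (K + 1) * \<bar>g x\<bar>"
      by (simp add: Q_def abs_mult[symmetric] left_diff_distrib)
  qed
  also have "\<dots> = e / (K + 1) * K" by (simp add: K_def)
  also have "\<dots> \<le> e" using e K by (simp add: field_simps)
  finally have "\<bar>integral S (\<lambda>x. P (u x) * g x) - integral S Q\<bar> \<le> e"
    using intP Qint by (simp add: Henstock_Kurzweil_Integration.integral_diff)
  then show "0 \<le> integral S (\<lambda>x. P (u x) * g x) + e" using Q0 by linarith
qed

text \<open>With \<open>u x = exp (- (h * x))\<close> the transforms at \<open>s + k h\<close> are
  the moments of \<open>exp (- s x) f x\<close>. If \<open>f\<close> were negative near
  \<open>x0\<close>, a bump in \<open>u\<close> concentrated there would have a negative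
  integral.\<close>

lemma nonneg_of_totally_monotone_laplace:
  fixes f :: "real \<Rightarrow> real"
  assumes cont: "continuous_on {0..} f" and h: "0 < h"
    and int: "\<And>k::nat. (\<lambda>x. exp (- (s + real k * h) * x) * f x) absolutely_integrable_on {0..}"
    and tm: "totally_monotone (\<lambda>k. integral {0..} (\<lambda>x. exp (- (s + real k * h) * x) * f x))"
    and x0: "0 \<le> x0"
  shows "0 \<le> f x0"
proof (rule ccontr)
  assume "\<not> 0 \<le> f x0"
  then have neg: "f x0 < 0" by simp
  define u where "u x = exp (- (h * x))" for x
  define g where "g x = exp (- (s * x)) * f x" for x
  have ug: "u x ^ k * g x = exp (- (s + real k * h) * x) * f x" for k x
    by (simp add: u_def g_def exp_of_nat_mult[symmetric] exp_add[symmetric] mult.assoc[symmetric])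
       (simp add: algebra_simps)
  have int': "(\<lambda>x. u x ^ k * g x) absolutely_integrable_on {0..}" for k
    unfolding ug by (rule int)
  have tm': "totally_monotone (\<lambda>k. integral {0..} (\<lambda>x. u x ^ k * g x))"
    unfolding ug by (rule tm)
  have u01: "u x \<in> {0..1}" if "x \<in> {0..}" for x
    using that h by (auto simp: u_def)
  from cont x0 neg obtain d where d: "d > 0" "\<And>x. x \<ge> 0 \<Longrightarrow> \<bar>x - x0\<bar> < d \<Longrightarrow> f x < 0"
  proof -
    have lim: "(f \<longlongrightarrow> f x0) (at x0 within {0..})"
      using cont x0 by (auto simp: continuous_on_def)
    have "eventually (\<lambda>x. f x < 0) (at x0 within {0..})"
      using order_tendstoD(2)[OF lim neg] .
    then obtain d where "d > 0" "\<And>x. x \<in> {0..} \<Longrightarrow> x \<noteq> x0 \<Longrightarrow> dist x x0 < d \<Longrightarrow> f x < 0"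
      unfolding eventually_at by blast
    then show ?thesis using that[of d] neg by (force simp: dist_real_def)
  qed
  \<comment> \<open>Since \<open>u\<close> is strictly decreasing, a \<open>u\<close>-distance below
    \<open>\<delta>\<close> forces \<open>x\<close> within \<open>d\<close> of \<open>x0\<close>.
    The point \<open>x0 - d\<close> may be negative, which is harmless because \<open>u\<close> is
    defined everywhere.\<close>
  define \<delta> where "\<delta> = min (u x0 - u (x0 + d)) (u (x0 - d) - u x0)"
  have \<delta>: "\<delta> > 0" using d(1) h by (simp add: \<delta>_def u_def)
  have near: "\<bar>x - x0\<bar> < d" if "\<bar>u x - u x0\<bar> < \<delta>" for x
  proof -
    have "u (x0 + d) < u x" "u x < u (x0 - d)" using that by (auto simp: \<delta>_def)
    then have "h * x < h * (x0 + d)" "h * (x0 - d) < h * x" by (simp_all add: u_def)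
    then show ?thesis using h by (simp add: abs_less_iff)
  qed
  \<comment> \<open>A tent of height \<open>\<delta>\<close> at \<open>u x0\<close>, vanishing at
    distance \<open>\<delta>\<close>.\<close>
  define P where "P t = max 0 (\<delta> - \<bar>t - u x0\<bar>)" for t
  have contP: "continuous_on A P" for A
    unfolding P_def by (intro continuous_intros)
  have contu: "continuous_on A u" for A
    unfolding u_def by (intro continuous_intros)
  have contPu: "continuous_on A (\<lambda>x. P (u x))" for A
    using continuous_on_compose[OF contu contP] by (simp add: o_def)
  have contg: "continuous_on {0..} g"
    unfolding g_def using cont by (intro continuous_intros)
  have g: "g absolutely_integrable_on {0..}" using int'[of 0] by simp
  have "(\<lambda>x. P (u x) * g x) absolutely_integrable_on {0..}"
  proof (rule absolutely_integrable_bounded_measurable_product_real)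
    show "(\<lambda>x. P (u x)) \<in> borel_measurable (lebesgue_on {0..})"
      using contPu by (intro continuous_imp_measurable_on_sets_lebesgue) auto
    have "0 \<le> P t \<and> P t \<le> \<delta>" for t using \<delta> by (auto simp: P_def)
    then show "bounded ((\<lambda>x. P (u x)) ` {0..})"
      by (intro boundedI[of _ \<delta>]) (auto simp: abs_of_nonneg)
  qed (use g in auto)
  then have intP: "(\<lambda>x. P (u x) * g x) integrable_on {0..}"
    by (rule set_lebesgue_integral_eq_integral(1))
  have np: "P (u x) * g x \<le> 0" if "x \<ge> 0" for x
  proof (cases "\<bar>u x - u x0\<bar> < \<delta>")
    case True
    then have "g x < 0" using d(2)[OF that] near by (simp add: g_def mult_pos_neg)
    then show ?thesis by (simp add: P_def mult_nonneg_nonpos)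
  next
    case False
    then show ?thesis by (simp add: P_def)
  qed
  have I0: "0 \<le> integral {0..} (\<lambda>x. P (u x) * g x)"
    by (rule moments_positive_functional[OF int' tm' u01 contP _ intP]) (auto simp: P_def)
  \<comment> \<open>An interval to the right of \<open>x0\<close> stays in the half-line even for
    \<open>x0 = 0\<close>. The integrand is continuous and has one sign there, so a zero integral
    makes it vanish at \<open>x0\<close>, where it is not zero.\<close>
  let ?J = "{x0..x0+1}"
  have contJ: "continuous_on ?J (\<lambda>x. - (P (u x) * g x))"
    using x0 by (intro continuous_intros contPu continuous_on_subset[OF contg]) auto
  have "integral ?J (\<lambda>x. - (P (u x) * g x)) \<le> integral {0..} (\<lambda>x. - (P (u x) * g x))"
    using x0 np contJ intP by (intro integral_subset_le integrable_continuous_real) (auto intro: integrable_neg)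
  also have "\<dots> \<le> 0" using I0 by simp
  finally have "integral ?J (\<lambda>x. - (P (u x) * g x)) \<le> 0" .
  moreover have "0 \<le> integral ?J (\<lambda>x. - (P (u x) * g x))"
    using np x0 contJ by (intro Henstock_Kurzweil_Integration.integral_nonneg integrable_continuous_real) auto
  ultimately have "integral ?J (\<lambda>x. - (P (u x) * g x)) = 0" by simp
  then have "\<forall>x\<in>?J. - (P (u x) * g x) = 0"
    using contJ np x0 by (subst (asm) integral_eq_0_iff) auto
  then have "P (u x0) * g x0 = 0" by auto
  then show False using \<delta> neg by (auto simp: P_def g_def)
qed

subsection \<open>The Laplace exponent and its difference quotients\<close>

text \<open>Away from \<open>a = b\<close>, where division by zero gives 0, this is the convolution
  on \<open>[0, x]\<close> of the exponentials with rates \<open>a\<close> and \<open>b\<close>; it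
  is also minus the divided difference of \<open>exp (- (t * x))\<close> in
  \<open>t\<close>.\<close>

definition exp_quotient :: "real \<Rightarrow> real \<Rightarrow> real \<Rightarrow> real" where
  "exp_quotient a b x = (exp (- (a * x)) - exp (- (b * x))) / (b - a)"

lemma exp_quotient_integral:
  assumes "a \<noteq> b" "0 \<le> x"
  shows "set_integrable lborel {0..x} (\<lambda>y. exp (- (a * (x - y))) * exp (- (b * y)))"
    and "exp_quotient a b x = (LBINT y:{0..x}. exp (- (a * (x - y))) * exp (- (b * y)))"
proof -
  show "set_integrable lborel {0..x} (\<lambda>y. exp (- (a * (x - y))) * exp (- (b * y)))"
    by (intro borel_integrable_atLeastAtMost' continuous_intros)
  define F where "F y = exp (- (a * (x - y))) * exp (- (b * y)) / (a - b)" for y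
  have "(LBINT y:{0..x}. exp (- (a * (x - y))) * exp (- (b * y))) = F x - F 0"
    unfolding set_lebesgue_integral_def
  proof (intro integral_FTC_Icc assms continuous_intros)
    fix y
    have "((\<lambda>y. exp (- (a * (x - y))) * exp (- (b * y))) has_real_derivative
        exp (- (a * (x - y))) * exp (- (b * y)) * (a - b)) (at y within {0..x})"
      by (auto intro!: derivative_eq_intros simp: algebra_simps)
    from DERIV_cdivide[OF this, of "a - b"]
    have "(F has_real_derivative (exp (- (a * (x - y))) * exp (- (b * y)) * (a - b)) / (a - b)) (at y within {0..x})"
      unfolding F_def .
    then show "(F has_vector_derivative exp (- (a * (x - y))) * exp (- (b * y))) (at y within {0..x})"
      using assms by (simp add: has_real_derivative_iff_has_vector_derivative)
  qed
  also have "\<dots> = exp_quotient a b x"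
    by (simp add: F_def exp_quotient_def diff_divide_distrib[symmetric])
       (metis minus_diff_eq minus_divide_divide)
  finally show "exp_quotient a b x = (LBINT y:{0..x}. exp (- (a * (x - y))) * exp (- (b * y)))" ..
qed

text \<open>By the convolution formula this is a mixture, with nonnegative weights, of exponentials
  in the second rate.\<close>

lemma totally_monotone_exp_quotient:
  assumes ne: "\<And>k. s + real k * h \<noteq> a" and "0 \<le> x" "0 \<le> h"
  shows "totally_monotone (\<lambda>k. exp_quotient a (s + real k * h) x)"
proof -
  have "totally_monotone (\<lambda>k. \<integral>y. indicator {0..x} y *\<^sub>R (exp (- (a * (x - y))) * exp (- ((s + real k * h) * y))) \<partial>lborel)"
  proof (rule totally_monotone_integral)
    fix y
    show "totally_monotone (\<lambda>k. indicator {0..x} y *\<^sub>R (exp (- (a * (x - y))) * exp (- ((s + real k * h) * y))))"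
      using assms by (cases "y \<in> {0..x}") (auto intro!: totally_monotone_exp totally_monotone_const)
  next
    fix k
    show "integrable lborel (\<lambda>y. indicator {0..x} y *\<^sub>R (exp (- (a * (x - y))) * exp (- ((s + real k * h) * y))))"
      using exp_quotient_integral(1)[of a "s + real k * h" x] ne[of k] assms by (simp add: set_integrable_def)
  qed
  then show ?thesis
    using exp_quotient_integral(2)[OF ne[symmetric] \<open>0 \<le> x\<close>]
    by (simp add: set_lebesgue_integral_def)
qed

text \<open>The quotient is the integral over \<open>y\<close> in \<open>[0, x]\<close> of
  \<open>exp (- (a * (x - y))) * exp_quotient 0 b y\<close> with \<open>b = s + k h\<close>, and
  \<open>exp_quotient 0 b y\<close> is totally monotone along the progression.\<close>

lemma totally_monotone_exp_quotient_diff: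
  assumes ne: "\<And>k. s + real k * h \<noteq> a" and "0 < a" "0 \<le> x" "0 \<le> h" "0 < s"
  shows "totally_monotone (\<lambda>k. (exp_quotient a 0 x - exp_quotient a (s + real k * h) x) / (s + real k * h))"
proof -
  have eq: "indicator {0..x} y *\<^sub>R (exp (- (a * (x - y))) * exp_quotient 0 b y) =
     (indicator {0..x} y *\<^sub>R (exp (- (a * (x - y))) * exp (- (0 * y))) -
      indicator {0..x} y *\<^sub>R (exp (- (a * (x - y))) * exp (- (b * y)))) / b" for y b
    by (cases "y \<in> {0..x}") (simp_all add: exp_quotient_def diff_divide_distrib right_diff_distrib)
  have pos: "s + real k * h > 0" for k
    using assms by (simp add: add_pos_nonneg)
  have int: "integrable lborel (\<lambda>y. indicator {0..x} y *\<^sub>R (exp (- (a * (x - y))) * exp (- (b * y))))"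
    if "b \<noteq> a" for b
    using exp_quotient_integral(1)[of a b x] that assms by (simp add: set_integrable_def)
  have "totally_monotone (\<lambda>k. \<integral>y. indicator {0..x} y *\<^sub>R (exp (- (a * (x - y))) * exp_quotient 0 (s + real k * h) y) \<partial>lborel)"
  proof (rule totally_monotone_integral)
    fix y
    have "totally_monotone (\<lambda>k. exp_quotient 0 (s + real k * h) y)" if "0 \<le> y"
      using that assms(4) less_imp_neq[OF pos] by (intro totally_monotone_exp_quotient) metis+
    then show "totally_monotone (\<lambda>k. indicator {0..x} y *\<^sub>R (exp (- (a * (x - y))) * exp_quotient 0 (s + real k * h) y))"
      by (cases "y \<in> {0..x}") (auto intro!: totally_monotone_mult totally_monotone_const)
  next
    fix k
    show "integrable lborel (\<lambda>y. indicator {0..x} y *\<^sub>R (exp (- (a * (x - y))) * exp_quotient 0 (s + real k * h) y))"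
      unfolding eq using assms ne[of k]
      by (intro integrable_divide Bochner_Integration.integrable_diff int) auto
  qed
  also have "(\<lambda>k. \<integral>y. indicator {0..x} y *\<^sub>R (exp (- (a * (x - y))) * exp_quotient 0 (s + real k * h) y) \<partial>lborel) =
      (\<lambda>k. (exp_quotient a 0 x - exp_quotient a (s + real k * h) x) / (s + real k * h))"
  proof
    fix k
    show "(\<integral>y. indicator {0..x} y *\<^sub>R (exp (- (a * (x - y))) * exp_quotient 0 (s + real k * h) y) \<partial>lborel) =
      (exp_quotient a 0 x - exp_quotient a (s + real k * h) x) / (s + real k * h)"
      unfolding eq using assms int[of 0] int[OF ne[of k]]
        exp_quotient_integral(2)[OF ne[of k, symmetric] \<open>0 \<le> x\<close>] exp_quotient_integral(2)[of a 0 x]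
      by (simp only: Bochner_Integration.integral_divide_zero Bochner_Integration.integral_diff
          set_lebesgue_integral_def)
  qed
  finally show ?thesis .
qed

text \<open>For \<open>x < 1\<close> this is the estimate
  \<open>0 \<le> exp (- t) - 1 + t \<le> t * t\<close> for \<open>t \<ge> 0\<close>; for larger
  \<open>x\<close> the left side is at most 1. The factor covers both cases and increases with
  \<open>\<theta>\<close>, which makes the bound uniform on bounded sets.\<close>

lemma compensated_exp_bound:
  fixes \<theta> x :: real
  assumes "0 \<le> \<theta>" "0 < x"
  shows "\<bar>1 - exp (- \<theta> * x) - \<theta> * x * indicator {0<..<1} x\<bar> \<le> (1 + \<theta>)\<^sup>2 * min 1 (x\<^sup>2)"
proof (cases "x < 1")
  case True
  have u: "0 \<le> \<theta> * x" using assms by simp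
  have 1: "1 - exp (- (\<theta> * x)) - \<theta> * x \<le> 0" using exp_ge_add_one_self[of "- (\<theta> * x)"] by simp
  have "exp (- (\<theta> * x)) \<le> 1 - \<theta> * x + (\<theta> * x)\<^sup>2"
  proof (cases "\<theta> * x \<le> 1")
    case True
    have "(1 + \<theta> * x) * exp (- (\<theta> * x)) \<le> exp (\<theta> * x) * exp (- (\<theta> * x))"
      by (intro mult_right_mono) auto
    then have "exp (- (\<theta> * x)) \<le> 1 / (1 + \<theta> * x)" using u by (simp add: exp_minus field_simps)
    also have "\<dots> \<le> 1 - \<theta> * x + (\<theta> * x)\<^sup>2"
    proof -
      have "1 \<le> (1 - \<theta> * x + (\<theta> * x)\<^sup>2) * (1 + \<theta> * x)"
      proof -
        have "(1 - \<theta> * x + (\<theta> * x)\<^sup>2) * (1 + \<theta> * x) = 1 + (\<theta> * x)^3"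
          by (simp add: algebra_simps power2_eq_square power3_eq_cube)
        then show ?thesis using u by simp
      qed
      then show ?thesis using u by (simp add: field_simps)
    qed
    finally show ?thesis .
  next
    case False
    then have "\<theta> * x \<le> (\<theta> * x)\<^sup>2" by (intro self_le_power) auto
    moreover have "exp (- (\<theta> * x)) \<le> 1" using u by simp
    ultimately show ?thesis by linarith
  qed
  with 1 have "\<bar>1 - exp (- (\<theta> * x)) - \<theta> * x\<bar> \<le> \<theta>\<^sup>2 * x\<^sup>2" by (simp add: power_mult_distrib)
  also have "\<dots> \<le> (1 + \<theta>)\<^sup>2 * x\<^sup>2" using assms by (intro mult_right_mono power_mono) auto
  also have "x\<^sup>2 = min 1 (x\<^sup>2)" using True assms by (simp add: min_absorb2 power_le_one)
  finally show ?thesis using True assms by simp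
next
  case False
  then have "min 1 (x\<^sup>2) = 1" by (simp add: min_def)
  moreover have "\<bar>1 - exp (- (\<theta> * x))\<bar> \<le> 1" using assms by (simp add: abs_le_iff add_nonneg_nonneg)
  moreover have "1 \<le> (1 + \<theta>)\<^sup>2" using assms by simp
  ultimately have "\<bar>1 - exp (- (\<theta> * x))\<bar> \<le> (1 + \<theta>)\<^sup>2 * min 1 (x\<^sup>2)"
    by linarith
  then show ?thesis using False by simp
qed

text \<open>Isolates the Levy-Khintchine formula on nonnegative arguments, so that the analysis of
  \<open>\<psi>\<close> refers to no probability space.\<close>

locale laplace_exponent_formula =
  fixes \<psi> :: "real \<Rightarrow> real" and \<gamma> \<sigma> :: real and \<upsilon> :: "real measure"
  assumes levy: "levy_measure \<upsilon>"
    and psi: "\<And>\<theta>. 0 \<le> \<theta> \<Longrightarrow> \<psi> \<theta> = \<gamma> * \<theta> + 1/2 * \<sigma>\<^sup>2 * \<theta>\<^sup>2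
          - (LINT x:{0<..}|\<upsilon>. 1 - exp (- \<theta> * x) - \<theta> * x * indicator {0<..<1} x)"
begin

lemma sets_levy [measurable_cong, simp]: "sets \<upsilon> = sets borel"
  using levy by (simp add: levy_measure_def)

lemma min_integrable: "set_integrable \<upsilon> {0<..} (\<lambda>x. min 1 (x\<^sup>2))"
proof -
  have "(\<integral>\<^sup>+x. ennreal (indicator {0<..} x *\<^sub>R min 1 (x\<^sup>2)) \<partial>\<upsilon>) = (\<integral>\<^sup>+x\<in>{0<..}. ennreal (min 1 (x\<^sup>2)) \<partial>\<upsilon>)"
    by (intro nn_integral_cong) (auto simp: indicator_def)
  also have "\<dots> < \<infinity>" using levy by (simp add: levy_measure_def)
  finally show ?thesis unfolding set_integrable_def
    by (intro integrableI_nonneg) (auto simp: indicator_def)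
qed

lemma compensated_exp_integrable:
  assumes "0 \<le> \<theta>"
  shows "set_integrable \<upsilon> {0<..} (\<lambda>x. 1 - exp (- \<theta> * x) - \<theta> * x * indicator {0<..<1} x)"
proof (rule set_integrable_bound)
  show "set_integrable \<upsilon> {0<..} (\<lambda>x. (1 + \<theta>)\<^sup>2 * min 1 (x\<^sup>2))"
    using min_integrable by (rule set_integrable_mult_right)
  show "set_borel_measurable \<upsilon> {0<..} (\<lambda>x. 1 - exp (- \<theta> * x) - \<theta> * x * indicator {0<..<1} x)"
    unfolding set_borel_measurable_def by measurable
  show "AE x in \<upsilon>. x \<in> {0<..} \<longrightarrow> norm (1 - exp (- \<theta> * x) - \<theta> * x * indicator {0<..<1} x)
      \<le> norm ((1 + \<theta>)\<^sup>2 * min 1 (x\<^sup>2))"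
    using compensated_exp_bound[OF assms] by (auto simp: abs_mult)
qed

lemma psi_0 [simp]: "\<psi> 0 = 0"
  by (subst psi) simp_all

text \<open>Dominated convergence along sequences: a convergent sequence is bounded by some
  \<open>K\<close>, and the compensated integrands are then dominated with the constant for
  \<open>K\<close>.\<close>

lemma psi_continuous: "continuous_on {0..} \<psi>"
proof (rule continuous_on_sequentiallyI)
  fix u :: "nat \<Rightarrow> real" and a assume u: "\<forall>n. u n \<in> {0..}" "a \<in> {0..}" "u \<longlonglongrightarrow> a"
  obtain K where K: "\<And>n. \<bar>u n\<bar> \<le> K"
    using convergent_imp_Bseq[of u] u(3) by (auto simp: convergent_def Bseq_def)
  have "(\<lambda>n. LINT x:{0<..}|\<upsilon>. 1 - exp (- u n * x) - u n * x * indicator {0<..<1} x)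
      \<longlonglongrightarrow> (LINT x:{0<..}|\<upsilon>. 1 - exp (- a * x) - a * x * indicator {0<..<1} x)"
    unfolding set_lebesgue_integral_def
  proof (rule integral_dominated_convergence)
    show "integrable \<upsilon> (\<lambda>x. indicator {0<..} x *\<^sub>R ((1 + K)\<^sup>2 * min 1 (x\<^sup>2)))"
      using set_integrable_mult_right[OF min_integrable, of "(1 + K)\<^sup>2"] unfolding set_integrable_def by simp
    show "AE x in \<upsilon>. (\<lambda>n. indicator {0<..} x *\<^sub>R (1 - exp (- u n * x) - u n * x * indicator {0<..<1} x))
      \<longlonglongrightarrow> indicator {0<..} x *\<^sub>R (1 - exp (- a * x) - a * x * indicator {0<..<1} x)"
      by (intro AE_I2 tendsto_intros u)
    fix n
    show "AE x in \<upsilon>. norm (indicator {0<..} x *\<^sub>R (1 - exp (- u n * x) - u n * x * indicator {0<..<1} x))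
        \<le> indicator {0<..} x *\<^sub>R ((1 + K)\<^sup>2 * min 1 (x\<^sup>2))"
    proof (intro AE_I2)
      fix x
      have "u n \<ge> 0" using u by auto
      then have "(1 + u n)\<^sup>2 * min 1 (x\<^sup>2) \<le> (1 + K)\<^sup>2 * min 1 (x\<^sup>2)"
        using K[of n] by (intro mult_right_mono power_mono) auto
      then show "norm (indicator {0<..} x *\<^sub>R (1 - exp (- u n * x) - u n * x * indicator {0<..<1} x))
        \<le> indicator {0<..} x *\<^sub>R ((1 + K)\<^sup>2 * min 1 (x\<^sup>2))"
        using order_trans[OF compensated_exp_bound[OF \<open>u n \<ge> 0\<close>, of x]]
        by (cases "x > 0") (simp_all only: indicator_simps greaterThan_iff scaleR_one scaleR_zero_left real_norm_def abs_zero order_refl simp_thms)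
    qed
  qed measurable
  then have "(\<lambda>n. \<gamma> * u n + 1/2 * \<sigma>\<^sup>2 * (u n)\<^sup>2
          - (LINT x:{0<..}|\<upsilon>. 1 - exp (- u n * x) - u n * x * indicator {0<..<1} x)) \<longlonglongrightarrow>
      \<gamma> * a + 1/2 * \<sigma>\<^sup>2 * a\<^sup>2 - (LINT x:{0<..}|\<upsilon>. 1 - exp (- a * x) - a * x * indicator {0<..<1} x)"
    by (intro tendsto_intros u)
  then show "(\<lambda>n. \<psi> (u n)) \<longlonglongrightarrow> \<psi> a" using u psi by simp
qed

text \<open>If \<open>\<psi> \<Phi> = q\<close>, this is, up to normalization, the Laplace exponent
  of the killed descending ladder height process. At \<open>\<theta> = \<Phi>\<close> it is 0 by
  division by zero instead of the derivative, hence the side conditions below.\<close>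

definition diff_quot :: "real \<Rightarrow> real \<Rightarrow> real" where
  "diff_quot \<Phi> \<theta> = (\<psi> \<theta> - \<psi> \<Phi>) / (\<theta> - \<Phi>)"

text \<open>The integral is kept in one piece because the compensator
  \<open>x * indicator {0<..<1} x\<close> alone may fail to be integrable.\<close>

lemma diff_quot_formula:
  assumes "0 \<le> \<Phi>" "0 \<le> \<theta>" "\<theta> \<noteq> \<Phi>"
  shows "set_integrable \<upsilon> {0<..} (\<lambda>x. x * indicator {0<..<1} x - exp_quotient \<Phi> \<theta> x)"
    and "diff_quot \<Phi> \<theta> = \<gamma> + 1/2 * \<sigma>\<^sup>2 * (\<theta> + \<Phi>) + (LINT x:{0<..}|\<upsilon>. x * indicator {0<..<1} x - exp_quotient \<Phi> \<theta> x)"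
proof -
  let ?l = "\<lambda>\<theta> x. 1 - exp (- \<theta> * x) - \<theta> * x * indicator {0<..<1} x"
  have eq: "(\<lambda>x. x * indicator {0<..<1} x - exp_quotient \<Phi> \<theta> x) = (\<lambda>x. (?l \<Phi> x - ?l \<theta> x) / (\<theta> - \<Phi>))"
    using assms by (auto simp: exp_quotient_def field_simps)
  show "set_integrable \<upsilon> {0<..} (\<lambda>x. x * indicator {0<..<1} x - exp_quotient \<Phi> \<theta> x)"
    unfolding eq using assms by (intro set_integrable_divide set_integral_diff compensated_exp_integrable) auto
  have "(LINT x:{0<..}|\<upsilon>. x * indicator {0<..<1} x - exp_quotient \<Phi> \<theta> x) =
     ((LINT x:{0<..}|\<upsilon>. ?l \<Phi> x) - (LINT x:{0<..}|\<upsilon>. ?l \<theta> x)) / (\<theta> - \<Phi>)"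
    unfolding eq using assms compensated_exp_integrable
    by (simp only: set_integral_divide_zero set_integral_diff)
  then show "diff_quot \<Phi> \<theta> = \<gamma> + 1/2 * \<sigma>\<^sup>2 * (\<theta> + \<Phi>) + (LINT x:{0<..}|\<upsilon>. x * indicator {0<..<1} x - exp_quotient \<Phi> \<theta> x)"
    unfolding diff_quot_def using assms(3)
    by (simp add: psi assms divide_simps) (simp add: algebra_simps power2_eq_square)
qed

text \<open>Subtracting two difference quotients cancels both the drift and the compensator.\<close>

lemma diff_quot_diff:
  assumes "0 \<le> \<Phi>" "0 \<le> \<theta>" "\<theta> \<noteq> \<Phi>" "0 \<le> \<eta>" "\<eta> \<noteq> \<Phi>"
  shows "set_integrable \<upsilon> {0<..} (\<lambda>x. exp_quotient \<Phi> \<theta> x - exp_quotient \<Phi> \<eta> x)"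
    and "diff_quot \<Phi> \<eta> - diff_quot \<Phi> \<theta> =
      1/2 * \<sigma>\<^sup>2 * (\<eta> - \<theta>) + (LINT x:{0<..}|\<upsilon>. exp_quotient \<Phi> \<theta> x - exp_quotient \<Phi> \<eta> x)"
proof -
  have eq: "(\<lambda>x. exp_quotient \<Phi> \<theta> x - exp_quotient \<Phi> \<eta> x) =
    (\<lambda>x. (x * indicator {0<..<1} x - exp_quotient \<Phi> \<eta> x) - (x * indicator {0<..<1} x - exp_quotient \<Phi> \<theta> x))"
    by auto
  note 1 = diff_quot_formula[OF assms(1,4,5)] and 2 = diff_quot_formula[OF assms(1,2,3)]
  show "set_integrable \<upsilon> {0<..} (\<lambda>x. exp_quotient \<Phi> \<theta> x - exp_quotient \<Phi> \<eta> x)"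
    unfolding eq by (intro set_integral_diff 1 2)
  show "diff_quot \<Phi> \<eta> - diff_quot \<Phi> \<theta> =
      1/2 * \<sigma>\<^sup>2 * (\<eta> - \<theta>) + (LINT x:{0<..}|\<upsilon>. exp_quotient \<Phi> \<theta> x - exp_quotient \<Phi> \<eta> x)"
    unfolding eq 1(2) 2(2) set_integral_diff(2)[OF 1(1) 2(1)] by algebra
qed

text \<open>Discrete form of the Bernstein property of the difference quotient: for each
  \<open>x\<close> the integrand is a first difference of a totally monotone sequence, and the
  Gaussian part adds a constant.\<close>

lemma totally_monotone_diff_quot_increments:
  assumes "0 \<le> \<Phi>" "0 \<le> s" "0 \<le> h" and ne: "\<And>k. s + real k * h \<noteq> \<Phi>"
  shows "totally_monotone (\<lambda>k. diff_quot \<Phi> (s + real (Suc k) * h) - diff_quot \<Phi> (s + real k * h))"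
proof -
  let ?t = "\<lambda>k. s + real k * h"
  have t: "0 \<le> ?t k" for k using assms by simp
  have int: "set_integrable \<upsilon> {0<..} (\<lambda>x. exp_quotient \<Phi> (?t k) x - exp_quotient \<Phi> (?t (Suc k)) x)" for k
    by (intro diff_quot_diff assms t ne)
  have "diff_quot \<Phi> (?t (Suc k)) - diff_quot \<Phi> (?t k) =
      1/2 * \<sigma>\<^sup>2 * h + (LINT x:{0<..}|\<upsilon>. exp_quotient \<Phi> (?t k) x - exp_quotient \<Phi> (?t (Suc k)) x)" for k
  proof -
    have h: "?t (Suc k) - ?t k = h" by (simp add: algebra_simps)
    show ?thesis using diff_quot_diff(2)[OF assms(1) t[of k] ne t[of "Suc k"] ne] unfolding h .
  qed
  moreover have "totally_monotone (\<lambda>k. 1/2 * \<sigma>\<^sup>2 * h +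
      (LINT x:{0<..}|\<upsilon>. exp_quotient \<Phi> (?t k) x - exp_quotient \<Phi> (?t (Suc k)) x))"
    unfolding set_lebesgue_integral_def
  proof (intro totally_monotone_add totally_monotone_const totally_monotone_integral)
    show "totally_monotone (\<lambda>k. indicator {0<..} x *\<^sub>R (exp_quotient \<Phi> (?t k) x - exp_quotient \<Phi> (?t (Suc k)) x))" for x
      using totally_monotone_diff[OF totally_monotone_exp_quotient[OF ne, of x]] assms
      by (cases "x > 0") (auto intro: totally_monotone_const)
    show "integrable \<upsilon> (\<lambda>x. indicator {0<..} x *\<^sub>R (exp_quotient \<Phi> (?t k) x - exp_quotient \<Phi> (?t (Suc k)) x))" for k
      using int[of k] by (simp add: set_integrable_def)
  qed (use assms in auto)
  ultimately show ?thesis by simp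
qed

text \<open>Counterpart of the fact that a Bernstein function minus its value at 0, divided by the
  argument, is completely monotone.\<close>

lemma totally_monotone_diff_quot_slope:
  assumes "0 < \<Phi>" "0 < s" "0 \<le> h" and ne: "\<And>k. s + real k * h \<noteq> \<Phi>"
  shows "totally_monotone (\<lambda>k. (diff_quot \<Phi> (s + real k * h) - diff_quot \<Phi> 0) / (s + real k * h))"
proof -
  let ?t = "\<lambda>k. s + real k * h"
  have t: "0 < ?t k" for k using assms by (simp add: add_pos_nonneg)
  have t0: "0 \<le> ?t k" for k using t[of k] by simp
  have P0: "0 \<le> \<Phi>" "0 \<noteq> \<Phi>" using assms by auto
  have int: "set_integrable \<upsilon> {0<..} (\<lambda>x. (exp_quotient \<Phi> 0 x - exp_quotient \<Phi> (?t k) x) / ?t k)" for k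
    by (intro set_integrable_divide diff_quot_diff P0 t0 ne order_refl)
  have "(diff_quot \<Phi> (?t k) - diff_quot \<Phi> 0) / ?t k =
      1/2 * \<sigma>\<^sup>2 + (LINT x:{0<..}|\<upsilon>. (exp_quotient \<Phi> 0 x - exp_quotient \<Phi> (?t k) x) / ?t k)" for k
  proof -
    have "diff_quot \<Phi> (?t k) - diff_quot \<Phi> 0 =
      1/2 * \<sigma>\<^sup>2 * ?t k + (LINT x:{0<..}|\<upsilon>. (exp_quotient \<Phi> 0 x - exp_quotient \<Phi> (?t k) x))"
      using diff_quot_diff(2)[OF P0(1) order_refl P0(2) t0[of k] ne] by simp
    moreover have "p = 1/2 * v * u + l \<Longrightarrow> 0 < u \<Longrightarrow> p / u = 1/2 * v + l / u" for p u v l :: real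
      by (simp add: field_simps)
    ultimately show ?thesis using t[of k] by (simp only: set_integral_divide_zero)
  qed
  moreover have "totally_monotone (\<lambda>k. 1/2 * \<sigma>\<^sup>2 +
      (LINT x:{0<..}|\<upsilon>. (exp_quotient \<Phi> 0 x - exp_quotient \<Phi> (?t k) x) / ?t k))"
    unfolding set_lebesgue_integral_def
  proof (intro totally_monotone_add totally_monotone_const totally_monotone_integral)
    show "totally_monotone (\<lambda>k. indicator {0<..} x *\<^sub>R ((exp_quotient \<Phi> 0 x - exp_quotient \<Phi> (?t k) x) / ?t k))" for x
      using totally_monotone_exp_quotient_diff[OF ne, of x] assms
      by (cases "x > 0") (auto intro: totally_monotone_const)
    show "integrable \<upsilon> (\<lambda>x. indicator {0<..} x *\<^sub>R ((exp_quotient \<Phi> 0 x - exp_quotient \<Phi> (?t k) x) / ?t k))" for k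
      using int[of k] by (simp add: set_integrable_def)
  qed simp
  ultimately show ?thesis by simp
qed

text \<open>The progression with step \<open>h = 0\<close> is constant, so total monotonicity of the
  slope reduces to its sign at one point.\<close>

lemma diff_quot_ge_0:
  assumes "0 < \<Phi>" "0 \<le> \<theta>" "\<theta> \<noteq> \<Phi>"
  shows "diff_quot \<Phi> 0 \<le> diff_quot \<Phi> \<theta>"
proof (cases "\<theta> = 0")
  case False
  then have "0 \<le> (diff_quot \<Phi> \<theta> - diff_quot \<Phi> 0) / \<theta>"
    using totally_monotone_nonneg[OF totally_monotone_diff_quot_slope[of \<Phi> \<theta> 0], of 0] assms by simp
  then show ?thesis using assms False by (simp add: zero_le_divide_iff)
qed simp

end

subsection \<open>Laplace transforms\<close>

text \<open>Absolute integrability is demanded because the moment argument multiplies the integrand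
  by bounded functions, which gauge integrability alone does not survive.\<close>

definition has_laplace :: "(real \<Rightarrow> real) \<Rightarrow> real \<Rightarrow> real \<Rightarrow> bool" where
  "has_laplace f s L \<longleftrightarrow>
     (\<lambda>x. exp (- s * x) * f x) absolutely_integrable_on {0..} \<and>
     integral {0..} (\<lambda>x. exp (- s * x) * f x) = L"

lemma has_laplace_has_integral:
  "has_laplace f s L \<Longrightarrow> ((\<lambda>x. exp (- s * x) * f x) has_integral L) {0..}"
  unfolding has_laplace_def using set_lebesgue_integral_eq_integral(1) by blast

lemma has_laplace_nonneg:
  assumes "((\<lambda>x. exp (- s * x) * f x) has_integral L) {0..}" "\<And>x. 0 \<le> x \<Longrightarrow> 0 \<le> f x"
  shows "has_laplace f s L"
  unfolding has_laplace_def using assms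
  by (intro conjI nonnegative_absolutely_integrable_1) (auto simp: integral_unique integrable_on_def)

lemma has_laplace_add:
  assumes "has_laplace f s L" "has_laplace g s K"
  shows "has_laplace (\<lambda>x. f x + g x) s (L + K)"
proof -
  have "(\<lambda>x. exp (- s * x) * f x + exp (- s * x) * g x) absolutely_integrable_on {0..}"
    using assms by (intro set_integral_add) (auto simp: has_laplace_def)
  moreover have "((\<lambda>x. exp (- s * x) * f x + exp (- s * x) * g x) has_integral (L + K)) {0..}"
    using assms by (intro has_integral_add has_laplace_has_integral)
  ultimately show ?thesis
    by (simp add: has_laplace_def distrib_left integral_unique)
qed

lemma has_laplace_cmult:
  assumes "has_laplace f s L"
  shows "has_laplace (\<lambda>x. c * f x) s (c * L)"
proof -
  have "(\<lambda>x. c * (exp (- s * x) * f x)) absolutely_integrable_on {0..}"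
    using assms by (intro set_integrable_mult_right) (auto simp: has_laplace_def)
  moreover have "((\<lambda>x. c * (exp (- s * x) * f x)) has_integral (c * L)) {0..}"
    using assms by (intro has_integral_mult_right has_laplace_has_integral)
  moreover have "(\<lambda>x. exp (- s * x) * (c * f x)) = (\<lambda>x. c * (exp (- s * x) * f x))"
    by (simp add: mult.left_commute)
  ultimately show ?thesis
    unfolding has_laplace_def by (simp only: integral_unique simp_thms)
qed

lemma has_laplace_diff:
  assumes "has_laplace f s L" "has_laplace g s K"
  shows "has_laplace (\<lambda>x. f x - g x) s (L - K)"
  using has_laplace_add[OF assms(1) has_laplace_cmult[OF assms(2), of "-1"]] by simp

lemma has_laplace_shift:
  assumes "has_laplace f s L"
  shows "has_laplace (\<lambda>x. exp (a * x) * f x) (s + a) L"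
proof -
  have "exp (- (s + a) * x) * (exp (a * x) * f x) = exp (- s * x) * f x" for x
    by (simp add: mult.assoc[symmetric] exp_add[symmetric] algebra_simps)
  then show ?thesis using assms by (simp only: has_laplace_def)
qed

lemma has_laplace_1:
  assumes "0 < s"
  shows "has_laplace (\<lambda>_. 1) s (1 / s)"
  using has_integral_exp_minus_to_infinity[OF assms, of 0]
  by (intro has_laplace_nonneg) simp_all

lemma has_laplace_tendsto:
  assumes "has_laplace f s L"
  shows "((\<lambda>y. integral {0..y} (\<lambda>x. exp (- s * x) * f x)) \<longlongrightarrow> L) at_top"
proof -
  let ?g = "\<lambda>x. exp (- s * x) * f x"
  have int: "set_integrable lebesgue {0..} ?g" using assms by (simp add: has_laplace_def)
  have "((\<lambda>y. set_lebesgue_integral lebesgue {0..y} ?g) \<longlongrightarrow> set_lebesgue_integral lebesgue {0..} ?g) at_top"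
    using int by (intro tendsto_set_lebesgue_integral_at_top) auto
  moreover have "set_lebesgue_integral lebesgue {0..} ?g = L"
    using set_lebesgue_integral_eq_integral(2)[OF int] assms by (simp add: has_laplace_def)
  moreover have "set_lebesgue_integral lebesgue {0..y} ?g = integral {0..y} ?g" for y
    using set_integrable_subset[OF int, of "{0..y}"] by (intro set_lebesgue_integral_eq_integral(2)) auto
  ultimately show ?thesis by simp
qed

section \<open>Antiderivatives and their transforms\<close>

text \<open>On \<open>[0, x]\<close> the weight \<open>exp (r * (x - y))\<close> is at least 1. The
  result limits the growth of the antiderivative to exponential rate \<open>r\<close>.\<close>

lemma antiderivative_bound:
  fixes f :: "real \<Rightarrow> real"
  assumes cont: "continuous_on {0..} f" and nonneg: "\<And>x. 0 \<le> x \<Longrightarrow> 0 \<le> f x"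
    and L: "has_laplace f r L" and "0 \<le> r" "0 \<le> x"
  shows "integral {0..x} f \<le> exp (r * x) * L"
proof -
  let ?g = "\<lambda>y. exp (- r * y) * f y"
  have c: "continuous_on {0..x} f" using cont by (rule continuous_on_subset) auto
  have "integral {0..x} f \<le> integral {0..x} (\<lambda>y. exp (r * x) * ?g y)"
  proof (intro integral_le integrable_continuous_real continuous_intros c)
    fix y assume y: "y \<in> {0..x}"
    have "1 * f y \<le> exp (r * (x - y)) * f y"
      using y nonneg[of y] assms(4) by (intro mult_right_mono) auto
    then show "f y \<le> exp (r * x) * ?g y"
      by (simp add: right_diff_distrib exp_diff exp_minus field_simps)
  qed
  also have "\<dots> = exp (r * x) * integral {0..x} ?g" by simp
  also have "integral {0..x} ?g \<le> integral {0..} ?g"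
    using has_laplace_has_integral[OF L] nonneg c
    by (intro integral_subset_le integrable_continuous_real continuous_intros) auto
  also have "integral {0..} ?g = L" using L by (simp add: has_laplace_def)
  finally show ?thesis by simp
qed

lemma antiderivative_deriv:
  fixes f :: "real \<Rightarrow> real"
  assumes cont: "continuous_on {0..} f" and "x \<in> {0..b}"
  shows "((\<lambda>x. integral {0..x} f) has_real_derivative f x) (at x within {0..b})"
  using assms by (intro integral_has_real_derivative continuous_on_subset[OF cont]) auto

lemma antiderivative_continuous:
  fixes f :: "real \<Rightarrow> real"
  assumes cont: "continuous_on {0..} f"
  shows "continuous_on {0..} (\<lambda>x. integral {0..x} f)"
proof -
  have "continuous (at x within {0..}) (\<lambda>x. integral {0..x} f)" if "x \<ge> 0" for x
  proof -
    have "continuous (at x within {0..x+1}) (\<lambda>x. integral {0..x} f)"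
      using antiderivative_deriv[OF cont, of x "x+1"] that DERIV_continuous by fastforce
    moreover have "at x within {0..x+1} = at x within {0..}"
      using that by (intro at_within_nhd[of _ "{..<x+1}"]) auto
    ultimately show ?thesis by simp
  qed
  then show ?thesis by (auto simp: continuous_on_eq_continuous_within)
qed

text \<open>Integration by parts on \<open>[0, y]\<close>. The transform at the smaller rate
  \<open>r\<close> makes the boundary term at \<open>y\<close> vanish in the limit.\<close>

lemma has_laplace_antiderivative:
  fixes f :: "real \<Rightarrow> real"
  assumes cont: "continuous_on {0..} f" and nonneg: "\<And>x. 0 \<le> x \<Longrightarrow> 0 \<le> f x"
    and K: "has_laplace f r K" "0 \<le> r" "r < s" and L: "has_laplace f s L"
  shows "has_laplace (\<lambda>x. integral {0..x} f) s (L / s)"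
proof (rule has_laplace_nonneg)
  let ?F = "\<lambda>x. integral {0..x} f"
  have s: "0 < s" using K by simp
  have Fc: "continuous_on {0..} ?F" by (rule antiderivative_continuous[OF cont])
  show F0: "0 \<le> ?F x" if "0 \<le> x" for x
    using nonneg continuous_on_subset[OF cont, of "{0..x}"]
    by (intro Henstock_Kurzweil_Integration.integral_nonneg integrable_continuous_real) auto
  have c1: "continuous_on {0..b} f" "continuous_on {0..b} ?F" for b
    using continuous_on_subset[OF cont, of "{0..b}"] continuous_on_subset[OF Fc, of "{0..b}"] by auto
  have parts: "integral {0..y} (\<lambda>x. exp (- s * x) * ?F x) =
      (integral {0..y} (\<lambda>x. exp (- s * x) * f x) - exp (- s * y) * ?F y) / s" if y: "0 \<le> y" for y
  proof -
    have "((\<lambda>x. exp (- s * x) * f x - s * (exp (- s * x) * ?F x)) has_integral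
       (exp (- s * y) * ?F y - exp (- s * 0) * ?F 0)) {0..y}"
    proof (rule fundamental_theorem_of_calculus[OF y])
      fix x assume x: "x \<in> {0..y}"
      have d: "(?F has_real_derivative f x) (at x within {0..y})"
        using x by (intro antiderivative_deriv cont) auto
      have "((\<lambda>x. exp (- s * x) * ?F x) has_real_derivative
          exp (- s * x) * f x - s * (exp (- s * x) * ?F x)) (at x within {0..y})"
        by (rule derivative_eq_intros d refl | simp)+
      then show "((\<lambda>x. exp (- s * x) * ?F x) has_vector_derivative
          exp (- s * x) * f x - s * (exp (- s * x) * ?F x)) (at x within {0..y})"
        by (simp add: has_real_derivative_iff_has_vector_derivative)
    qed
    then have "integral {0..y} (\<lambda>x. exp (- s * x) * f x - s * (exp (- s * x) * ?F x)) = exp (- s * y) * ?F y"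
      by (simp add: integral_unique)
    also have "integral {0..y} (\<lambda>x. exp (- s * x) * f x - s * (exp (- s * x) * ?F x)) =
       integral {0..y} (\<lambda>x. exp (- s * x) * f x) - s * integral {0..y} (\<lambda>x. exp (- s * x) * ?F x)"
      by (subst Henstock_Kurzweil_Integration.integral_diff)
        (auto intro!: integrable_continuous_real continuous_intros c1)
    finally show ?thesis using s by (simp add: field_simps)
  qed
  have "((\<lambda>y. exp (- s * y) * ?F y) \<longlongrightarrow> 0) at_top"
  proof (rule tendsto_sandwich[where f = "\<lambda>_. 0"])
    show "((\<lambda>y. exp (- (s - r) * y) * K) \<longlongrightarrow> 0) at_top"
    proof -
      have "((\<lambda>y. exp (- (s - r) * y)) \<longlongrightarrow> 0) at_top"
        using K by real_asymp
      then show ?thesis by (rule tendsto_mult_left_zero)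
    qed
    show "\<forall>\<^sub>F y in at_top. exp (- s * y) * ?F y \<le> exp (- (s - r) * y) * K"
      using eventually_ge_at_top[of 0]
    proof eventually_elim
      case (elim y)
      have "exp (- s * y) * ?F y \<le> exp (- s * y) * (exp (r * y) * K)"
        using antiderivative_bound[OF cont nonneg K(1,2) elim] by (intro mult_left_mono) auto
      also have "\<dots> = exp (- (s - r) * y) * K"
      proof -
        have "exp (- (s - r) * y) = exp (- s * y) * exp (r * y)"
          unfolding exp_add[symmetric] by (simp add: left_diff_distrib)
        then show ?thesis by simp
      qed
      finally show ?case .
    qed
    show "\<forall>\<^sub>F y in at_top. 0 \<le> exp (- s * y) * ?F y"
      using eventually_ge_at_top[of 0] by eventually_elim (simp add: F0)
  qed simp
  then have "((\<lambda>y. (integral {0..y} (\<lambda>x. exp (- s * x) * f x) - exp (- s * y) * ?F y) / s) \<longlongrightarrow> (L - 0) / s) at_top"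
    using s by (intro tendsto_intros has_laplace_tendsto L) auto
  moreover have "\<forall>\<^sub>F y in at_top. (integral {0..y} (\<lambda>x. exp (- s * x) * f x) - exp (- s * y) * ?F y) / s
      = integral {0..y} (\<lambda>x. exp (- s * x) * ?F x)"
    using eventually_ge_at_top[of 0] by eventually_elim (rule parts[symmetric])
  ultimately have "((\<lambda>y. integral {0..y} (\<lambda>x. exp (- s * x) * ?F x)) \<longlongrightarrow> (L - 0) / s) at_top"
    by (rule Lim_transform_eventually)
  then have "((\<lambda>y. integral {0..y} (\<lambda>x. exp (- s * x) * ?F x)) \<longlongrightarrow> L / s) at_top"
    by simp
  then show "((\<lambda>x. exp (- s * x) * ?F x) has_integral L / s) {0..}"
    using F0 by (intro has_integral_to_inf integrable_continuous_real continuous_intros c1) auto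
qed

lemma nonneg_of_has_laplace:
  fixes f :: "real \<Rightarrow> real"
  assumes cont: "continuous_on {0..} f" and h: "0 < h"
    and L: "\<And>k::nat. has_laplace f (s + real k * h) (l k)"
    and tm: "totally_monotone l" and x0: "0 \<le> x0"
  shows "0 \<le> f x0"
proof (rule nonneg_of_totally_monotone_laplace[OF cont h _ _ x0])
  show "(\<lambda>x. exp (- (s + real k * h) * x) * f x) absolutely_integrable_on {0..}" for k
    using L by (simp add: has_laplace_def)
  have "l = (\<lambda>k. integral {0..} (\<lambda>x. exp (- (s + real k * h) * x) * f x))"
    using L by (auto simp: has_laplace_def)
  then show "totally_monotone (\<lambda>k. integral {0..} (\<lambda>x. exp (- (s + real k * h) * x) * f x))"
    using tm by simp
qed

text \<open>With \<open>E\<^sub>l = V * exp (- l \<cdot>)\<close>, the transform of \<open>V - l E\<^sub>l\<close> is \<open>s v s / (s + l)\<close>, so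
  \<open>V \<ge> l E\<^sub>l\<close>. As \<open>E\<^sub>l' = V - l E\<^sub>l\<close>, the function \<open>l E\<^sub>l\<close> is nondecreasing, and it
  approximates \<open>V\<close> as \<open>l \<rightarrow> \<infinity>\<close>.\<close>

lemma nondecreasing_of_has_laplace:
  fixes V v :: "real \<Rightarrow> real"
  assumes cont: "continuous_on {0..} V" and nonneg: "\<And>x. 0 \<le> x \<Longrightarrow> 0 \<le> V x"
    and L: "\<And>s. 0 < s \<Longrightarrow> has_laplace V s (v s)"
    and tm: "totally_monotone (\<lambda>k. (1 + real k) * v (1 + real k))"
  shows "mono_on {0..} V"
proof -
  define E where "E l x = exp (- l * x) * integral {0..x} (\<lambda>y. exp (l * y) * V y)" for l x
  have contE: "continuous_on {0..} (\<lambda>y. exp (l * y) * V y)" for l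
    by (intro continuous_intros cont)
  have cE: "continuous_on {0..} (E l)" for l
    unfolding E_def by (intro continuous_intros antiderivative_continuous contE)
  have VE: "l * E l x \<le> V x" if l: "0 < l" and x: "0 \<le> x" for l x
  proof -
    have "has_laplace (E l) s (v s / (s + l))" if s: "0 < s" for s
    proof -
      have "has_laplace (\<lambda>y. exp (l * y) * V y) (s + l) (v s)"
        using has_laplace_shift[OF L[OF s]] .
      \<comment> \<open>The transform at \<open>s/2 + l\<close> provides the smaller rate needed to
        pass to the antiderivative.\<close>
      moreover have "has_laplace (\<lambda>y. exp (l * y) * V y) (s/2 + l) (v (s/2))"
        using s by (intro has_laplace_shift L) simp
      ultimately have "has_laplace (\<lambda>x. integral {0..x} (\<lambda>y. exp (l * y) * V y)) (s + l) (v s / (s + l))"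
        using s l nonneg by (intro has_laplace_antiderivative[OF contE, of l "s/2 + l"]) auto
      from has_laplace_shift[OF this, of "- l"] show ?thesis by (simp add: E_def[abs_def])
    qed
    then have lap: "has_laplace (\<lambda>x. V x - l * E l x) s (v s - l * (v s / (s + l)))" if "0 < s" for s
      using that by (intro has_laplace_diff has_laplace_cmult L)
    have "totally_monotone (\<lambda>k. 1 / (1 + real k + l))"
      using l by (intro totally_monotone_inverse) (auto intro: totally_monotone_const add_pos_nonneg)
    from totally_monotone_mult[OF tm this]
    have "totally_monotone (\<lambda>k. (1 + real k) * v (1 + real k) * (1 / (1 + real k + l)))" .
    moreover have "(1 + real k) * v (1 + real k) * (1 / (1 + real k + l)) =
        v (1 + real k) - l * (v (1 + real k) / (1 + real k + l))" for k
    proof -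
      have "1 + real k + l > 0" using l by simp
      then show ?thesis by (simp add: field_simps)
    qed
    ultimately have tm': "totally_monotone (\<lambda>k. v (1 + real k) - l * (v (1 + real k) / (1 + real k + l)))"
      by simp
    have "0 \<le> V x - l * E l x"
      by (rule nonneg_of_has_laplace[where h = 1 and s = 1, OF _ _ _ tm' x])
        (auto intro!: continuous_intros cont cE lap[of "1 + real k" for k, simplified])
    then show ?thesis by simp
  qed
  have Emono: "E l x \<le> E l y" if l: "0 < l" and xy: "0 \<le> x" "x \<le> y" for l x y
  proof (rule DERIV_nonneg_imp_increasing_open[OF xy(2)])
    show "continuous_on {x..y} (E l)"
      using cE xy by (rule_tac continuous_on_subset[OF cE]) auto
    fix z assume z: "x < z" "z < y"
    have "((\<lambda>x. integral {0..x} (\<lambda>y. exp (l * y) * V y)) has_real_derivative exp (l * z) * V z) (at z within {0..y})"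
      using z xy by (intro antiderivative_deriv contE) auto
    then have d: "((\<lambda>x. integral {0..x} (\<lambda>y. exp (l * y) * V y)) has_real_derivative exp (l * z) * V z) (at z)"
      using z xy by (simp add: at_within_Icc_at)
    have "(E l has_real_derivative V z - l * E l z) (at z)"
      unfolding E_def by (rule derivative_eq_intros d refl | simp add: exp_minus)+
    then show "\<exists>d. (E l has_real_derivative d) (at z) \<and> 0 \<le> d"
      using VE[OF l, of z] z xy by (intro exI[of _ "V z - l * E l z"]) auto
  qed
  have main: "V x \<le> V y" if xy: "0 < x" "x \<le> y" for x y
  proof (rule field_le_epsilon)
    fix e :: real assume e: "e > 0"
    show "V x \<le> V y + e"
    proof (cases "V x \<le> e")
      case True
      then show ?thesis using nonneg[of y] xy by simp
    next
      case False
      have "(V \<longlongrightarrow> V x) (at x within {0..})" using cont xy by (auto simp: continuous_on_def)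
      then have "eventually (\<lambda>u. V u > V x - e) (at x within {0..})"
        using e by (intro order_tendstoD) auto
      then obtain d where d: "d > 0" "\<And>u. u \<in> {0..} \<Longrightarrow> u \<noteq> x \<Longrightarrow> dist u x < d \<Longrightarrow> V u > V x - e"
        unfolding eventually_at by blast
      define r where "r = min (d/2) x"
      have r: "0 < r" "r \<le> x" "r < d" using d xy by (auto simp: r_def)
      have near: "V x - e \<le> V u" if "u \<in> {x - r..x}" for u
        using that r d(2)[of u] e by (cases "u = x") (auto simp: dist_real_def)
      \<comment> \<open>The kernel \<open>l * exp (- l * (x - u))\<close> has mass
        \<open>1 - exp (- l * r)\<close> on the window \<open>[x - r, x]\<close>, where
        \<open>V\<close> is at least \<open>V x - e\<close>. This mass tends to 1 as
        \<open>l\<close> grows.\<close>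
      have "(V x - e) * (1 - exp (- l * r)) \<le> V y" if l: "0 < l" for l
      proof -
        have "((\<lambda>u. (V x - e) * exp (l * u)) has_integral
            ((V x - e) * exp (l * x) / l - (V x - e) * exp (l * (x - r)) / l)) {x - r..x}"
          using r l by (intro fundamental_theorem_of_calculus)
            (auto intro!: derivative_eq_intros simp flip: has_real_derivative_iff_has_vector_derivative)
        then have "(V x - e) * exp (l * x) / l - (V x - e) * exp (l * (x - r)) / l =
            integral {x - r..x} (\<lambda>u. (V x - e) * exp (l * u))" by (rule integral_unique[symmetric])
        also have "\<dots> \<le> integral {x - r..x} (\<lambda>u. exp (l * u) * V u)"
          using near r by (intro integral_le integrable_continuous_real continuous_intros continuous_on_subset[OF cont])
            (auto simp: mult.commute)
        also have "\<dots> \<le> integral {0..x} (\<lambda>u. exp (l * u) * V u)"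
          using r nonneg by (intro integral_subset_le integrable_continuous_real continuous_intros continuous_on_subset[OF cont]) auto
        finally have "l * exp (- l * x) * ((V x - e) * exp (l * x) / l - (V x - e) * exp (l * (x - r)) / l) \<le> l * E l x"
          using l unfolding E_def mult.assoc by (intro mult_left_mono) auto
        also have "l * exp (- l * x) * ((V x - e) * exp (l * x) / l - (V x - e) * exp (l * (x - r)) / l) =
            (V x - e) * (1 - exp (- l * r))"
          using l by (simp add: right_diff_distrib exp_diff exp_minus field_simps)
        also have "l * E l x \<le> l * E l y" using Emono[OF l, of x y] l xy by simp
        also have "\<dots> \<le> V y" using VE[OF l, of y] xy by simp
        finally show ?thesis .
      qed
      then have ev: "\<forall>\<^sub>F l in at_top. (V x - e) * (1 - exp (- l * r)) \<le> V y"
        by (intro eventually_mono[OF eventually_gt_at_top[of 0]])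
      have "((\<lambda>l. 1 - exp (- l * r)) \<longlongrightarrow> 1) at_top" using r by real_asymp
      from tendsto_mult[OF tendsto_const this, of "V x - e"]
      have "((\<lambda>l. (V x - e) * (1 - exp (- l * r))) \<longlongrightarrow> V x - e) at_top" by simp
      from tendsto_upperbound[OF this ev] show ?thesis by simp
    qed
  qed
  show ?thesis
  proof (rule mono_onI)
    fix x y :: real assume xy: "x \<in> {0..}" "y \<in> {0..}" "x \<le> y"
    show "V x \<le> V y"
    \<comment> \<open>No window fits to the left of 0, so the value at 0 is reached as a limit from
      the right.\<close>
    proof (cases "x = 0 \<and> y > 0")
      case False
      then show ?thesis using main xy by (cases "x = y") auto
    next
      case True
      have "(V \<longlongrightarrow> V 0) (at 0 within {0..})" using cont by (auto simp: continuous_on_def)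
      then have lim: "(V \<longlongrightarrow> V 0) (at_right 0)" by (rule tendsto_within_subset) auto
      have "\<forall>\<^sub>F u in at_right 0. V u \<le> V y"
        using True main by (auto simp: eventually_at_right intro!: exI[of _ y])
      from tendsto_upperbound[OF lim this] show ?thesis using True by simp
    qed
  qed
qed

text \<open>Newton's series \<open>a 0 = (\<Sum>j. (\<Delta>\<^sup>j a) 1)\<close> with nonnegative terms, where \<open>\<Delta>\<close> is the backward
  difference. It bounds the transform to the left of its known half-line.\<close>

lemma newton_partial_sum_le:
  fixes g u :: "real \<Rightarrow> real"
  assumes "totally_monotone a" "\<And>k. ((\<lambda>x. u x ^ k * g x) has_integral a (Suc k)) S"
  shows "(\<lambda>x. (\<Sum>j<J. (1 - u x) ^ j) * g x) integrable_on S \<and>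
    integral S (\<lambda>x. (\<Sum>j<J. (1 - u x) ^ j) * g x) \<le> a 0"
  using assms
proof (induction J arbitrary: a g)
  case 0
  then show ?case using totally_monotone_nonneg[of a 0] by (simp add: integrable_0)
next
  case (Suc J)
  have "((\<lambda>x. u x ^ k * ((1 - u x) * g x)) has_integral (a (Suc k) - a (Suc (Suc k)))) S" for k
    using has_integral_diff[OF Suc.prems(2)[of k] Suc.prems(2)[of "Suc k"]]
    by (simp add: algebra_simps)
  from Suc.IH[OF totally_monotone_diff[OF Suc.prems(1)] this]
  have IH: "(\<lambda>x. (\<Sum>j<J. (1 - u x) ^ j) * ((1 - u x) * g x)) integrable_on S"
    "integral S (\<lambda>x. (\<Sum>j<J. (1 - u x) ^ j) * ((1 - u x) * g x)) \<le> a 0 - a 1" by simp_all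
  have g: "(g has_integral a 1) S" using Suc.prems(2)[of 0] by simp
  have eq: "(\<lambda>x. (\<Sum>j<Suc J. (1 - u x) ^ j) * g x) =
      (\<lambda>x. g x + (\<Sum>j<J. (1 - u x) ^ j) * ((1 - u x) * g x))"
  proof
    fix x
    have "(\<Sum>j<Suc J. (1 - u x) ^ j) = 1 + (1 - u x) * (\<Sum>j<J. (1 - u x) ^ j)"
      by (simp add: sum.lessThan_Suc_shift sum_distrib_left del: sum.lessThan_Suc)
    moreover have "(1 + v * t) * c = c + t * (v * c)" for v t c :: real
      by (simp add: algebra_simps)
    ultimately show "(\<Sum>j<Suc J. (1 - u x) ^ j) * g x =
        g x + (\<Sum>j<J. (1 - u x) ^ j) * ((1 - u x) * g x)"
      by (simp only:)
  qed
  have "((\<lambda>x. (\<Sum>j<Suc J. (1 - u x) ^ j) * g x) has_integral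
      (a 1 + integral S (\<lambda>x. (\<Sum>j<J. (1 - u x) ^ j) * ((1 - u x) * g x)))) S"
    unfolding eq by (intro has_integral_add g integrable_integral IH)
  then show ?case using IH(2) by (auto simp: integrable_on_def integral_unique)
qed

text \<open>Only the terms from \<open>a 1\<close> on are known transforms. Newton's partial sums
  insert the factor \<open>1 - (1 - u x) ^ J\<close>, which increases to 1, so \<open>a 0\<close>
  dominates the integral of \<open>exp (- s * x) * f x\<close> over \<open>[0, N]\<close>, where
  \<open>f\<close> is at least \<open>f N\<close>.\<close>

lemma laplace_continuation_bound:
  fixes f :: "real \<Rightarrow> real"
  assumes cont: "continuous_on {0..} f" and nonneg: "\<And>x. 0 \<le> x \<Longrightarrow> 0 \<le> f x"
    and anti: "\<And>x y. 0 \<le> x \<Longrightarrow> x \<le> y \<Longrightarrow> f y \<le> f x"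
    and s: "0 < s" and h: "0 < h" and N: "0 < N"
    and tm: "totally_monotone a"
    and L: "\<And>k. has_laplace f (s + real (Suc k) * h) (a (Suc k))"
  shows "f N * (1 - exp (- s * N)) / s \<le> a 0"
proof -
  define u where "u x = exp (- h * x)" for x
  define g where "g x = u x * (exp (- s * x) * f x)" for x
  have "u x ^ k * g x = exp (- (s + real (Suc k) * h) * x) * f x" for k x
  proof -
    have "u x ^ Suc k = exp (real (Suc k) * (- h * x))"
      unfolding u_def by (rule exp_of_nat_mult[symmetric])
    then have "u x ^ k * g x = exp (real (Suc k) * (- h * x)) * exp (- s * x) * f x"
      by (simp add: g_def mult_ac)
    also have "\<dots> = exp (real (Suc k) * (- h * x) + - s * x) * f x" by (simp only: exp_add)
    also have "real (Suc k) * (- h * x) + - s * x = - (s + real (Suc k) * h) * x"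
      by (simp add: algebra_simps)
    finally show ?thesis .
  qed
  then have I: "((\<lambda>x. u x ^ k * g x) has_integral a (Suc k)) {0..}" for k
    using has_laplace_has_integral[OF L[of k]] by simp
  have geo: "(\<Sum>j<J. (1 - u x) ^ j) * g x = (1 - (1 - u x) ^ J) * (exp (- s * x) * f x)" for J x
  proof -
    have "u x * (\<Sum>j<J. (1 - u x) ^ j) = 1 - (1 - u x) ^ J"
      using one_diff_power_eq[of "1 - u x" J] by simp
    then show ?thesis unfolding g_def by (metis mult.assoc mult.commute)
  qed
  have u1: "0 < u x" "u x \<le> 1" if "0 \<le> x" for x using that h by (auto simp: u_def)
  have cN: "continuous_on {0..N} f" using cont by (rule continuous_on_subset) auto
  have bound: "(1 - (1 - u N) ^ J) * (f N * (1 - exp (- s * N)) / s) \<le> a 0" for J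
  proof -
    let ?F = "\<lambda>x. (1 - (1 - u x) ^ J) * (exp (- s * x) * f x)"
    have F: "?F integrable_on {0..}" "integral {0..} ?F \<le> a 0"
      using newton_partial_sum_le[OF tm I, of J] unfolding geo by auto
    have Fc: "?F integrable_on {0..N}"
      unfolding u_def by (intro integrable_continuous_real continuous_intros cN)
    have "((\<lambda>x. exp (- s * x)) has_integral (- exp (- s * N) / s - (- exp (- s * 0) / s))) {0..N}"
      using s N by (intro fundamental_theorem_of_calculus)
        (auto intro!: derivative_eq_intros simp flip: has_real_derivative_iff_has_vector_derivative)
    from has_integral_mult_right[OF this, of "(1 - (1 - u N) ^ J) * f N"]
    have I2: "((\<lambda>x. (1 - (1 - u N) ^ J) * f N * exp (- s * x)) has_integral
        (1 - (1 - u N) ^ J) * (f N * (1 - exp (- s * N)) / s)) {0..N}"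
      using s by (simp add: diff_divide_distrib algebra_simps)
    \<comment> \<open>Both \<open>f\<close> and the truncation factor are smallest at the right end
      \<open>N\<close>.\<close>
    have "(1 - (1 - u N) ^ J) * (f N * (1 - exp (- s * N)) / s) \<le> integral {0..N} ?F"
    proof (rule has_integral_le[OF I2 integrable_integral[OF Fc]])
      fix x assume x: "x \<in> {0..N}"
      have "u N \<le> u x" using x h by (simp add: u_def)
      then have "(1 - u x) ^ J \<le> (1 - u N) ^ J"
        using u1[of x] x by (intro power_mono) auto
      moreover have "(1 - u N) ^ J \<le> 1" using u1[of N] N by (intro power_le_one) auto
      ultimately have "(1 - (1 - u N) ^ J) * (exp (- s * x) * f N) \<le> ?F x"
        using x nonneg[of N] N anti[of x N] by (intro mult_mono) auto
      then show "(1 - (1 - u N) ^ J) * f N * exp (- s * x) \<le> ?F x" by (simp add: mult_ac)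
    qed
    also have "\<dots> \<le> integral {0..} ?F"
    proof (rule integral_subset_le[OF _ Fc F(1)])
      show "\<forall>x\<in>{0..}. 0 \<le> ?F x"
        using u1 nonneg by (auto intro!: mult_nonneg_nonneg power_le_one simp: less_imp_le)
    qed auto
    finally show ?thesis using F(2) by simp
  qed
  have "0 < u N" "u N \<le> 1" using u1[of N] N by auto
  then have "(\<lambda>J. (1 - u N) ^ J) \<longlonglongrightarrow> 0"
    by (intro LIMSEQ_power_zero) auto
  then have "(\<lambda>J. (1 - (1 - u N) ^ J) * (f N * (1 - exp (- s * N)) / s)) \<longlonglongrightarrow>
      (1 - 0) * (f N * (1 - exp (- s * N)) / s)"
    by (intro tendsto_mult_right tendsto_diff tendsto_const)
  then have "(1 - 0) * (f N * (1 - exp (- s * N)) / s) \<le> a 0"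
    by (rule LIMSEQ_le_const2) (use bound in blast)
  then show ?thesis by simp
qed

subsection \<open>Monotonicity properties of the scale function\<close>

locale scale_function_setting = laplace_exponent_formula +
  fixes q :: real and W :: "real \<Rightarrow> real"
  assumes q: "0 < q" and scale: "scale_function \<psi> q W"
begin

lemma W_nonneg: "0 \<le> x \<Longrightarrow> 0 \<le> W x"
  and W_continuous: "continuous_on {0..} W"
  and W_less: "0 \<le> x \<Longrightarrow> x < y \<Longrightarrow> W x < W y"
  using scale by (auto simp: scale_function_def intro: strict_mono_onD)

lemma W_pos: "0 < x \<Longrightarrow> 0 < W x"
  using W_less[of 0 x] W_nonneg[of 0] by simp

lemma W_laplace: "largest_root \<psi> q < \<theta> \<Longrightarrow> has_laplace W \<theta> (1 / (\<psi> \<theta> - q))"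
  using scale W_nonneg by (intro has_laplace_nonneg) (auto simp: scale_function_def)

text \<open>Positivity of \<open>W\<close> forces a positive transform
  \<open>1 / (\<psi> \<theta> - q)\<close>. Equality \<open>\<psi> \<theta> = q\<close> is excluded
  too, since division by zero would give 0.\<close>

lemma psi_gt:
  assumes "largest_root \<psi> q < \<theta>" "0 \<le> \<theta>"
  shows "q < \<psi> \<theta>"
proof -
  have c: "continuous_on {0..1} W" by (rule continuous_on_subset[OF W_continuous]) auto
  have "integral {0..1} W \<noteq> 0"
    using integral_eq_0_iff[OF c] W_nonneg W_pos[of 1] by force
  moreover have "0 \<le> integral {0..1} W"
    using W_nonneg c by (intro Henstock_Kurzweil_Integration.integral_nonneg integrable_continuous_real) auto
  ultimately have "0 < integral {0..1} W" by simp
  also have "\<dots> \<le> exp (\<theta> * 1) * (1 / (\<psi> \<theta> - q))"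
    using W_continuous W_nonneg W_laplace[OF assms(1)] assms(2) by (intro antiderivative_bound) auto
  finally show ?thesis by (simp add: zero_less_divide_iff)
qed

definition \<Phi> :: real where "\<Phi> = largest_root \<psi> q"

text \<open>The \<open>GREATEST\<close> in \<open>largest_root\<close> means nothing until a largest
  root is known to exist. The intermediate value theorem gives a root, and \<open>psi_gt\<close>
  bounds the closed set of roots.\<close>

lemma psi_root: "\<psi> \<Phi> = q" and root_pos: "0 < \<Phi>"
proof -
  \<comment> \<open>A nonnegative point above \<open>largest_root\<close>, whatever value that still
    unidentified term has.\<close>
  define T where "T = max 0 (largest_root \<psi> q) + 1"
  define S where "S = {\<theta>\<in>{0..}. \<psi> \<theta> = q}"
  have T: "0 \<le> T" "q < \<psi> T" unfolding T_def by (auto intro!: psi_gt)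
  have "continuous_on {0..T} \<psi>" using psi_continuous by (rule continuous_on_subset) auto
  then obtain t where t: "0 \<le> t" "\<psi> t = q"
    using IVT'[of \<psi> 0 q T] T q by auto
  have "closed S"
    unfolding S_def using continuous_closed_preimage_constant[OF psi_continuous] by simp
  moreover have "S \<subseteq> {0..T}"
  proof
    fix x assume x: "x \<in> S"
    then have "\<not> largest_root \<psi> q < x" using psi_gt[of x] by (auto simp: S_def)
    then show "x \<in> {0..T}" using x by (auto simp: T_def S_def)
  qed
  ultimately have "compact S"
    using bounded_subset[OF bounded_closed_interval] by (simp add: compact_eq_bounded_closed)
  moreover have "S \<noteq> {}" using t by (auto simp: S_def)
  ultimately obtain m where m: "m \<in> S" "\<And>x. x \<in> S \<Longrightarrow> x \<le> m"
    using compact_attains_sup[of S] by auto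
  have "\<Phi> = m"
    unfolding \<Phi>_def largest_root_def using m by (intro Greatest_equality) (auto simp: S_def)
  then show "\<psi> \<Phi> = q" and "0 < \<Phi>"
    using m(1) q psi_0 by (auto simp: S_def order_le_less)
qed

lemma W_laplace_root: "\<Phi> < \<theta> \<Longrightarrow> has_laplace W \<theta> (1 / (\<psi> \<theta> - q))"
  using W_laplace by (simp add: \<Phi>_def)

lemma psi_gt_root: "\<Phi> < \<theta> \<Longrightarrow> q < \<psi> \<theta>"
  using psi_gt root_pos by (simp add: \<Phi>_def)

lemma diff_quot_0: "diff_quot \<Phi> 0 = q / \<Phi>"
  by (simp add: diff_quot_def psi_root)

lemma diff_quot_pos: "0 \<le> \<theta> \<Longrightarrow> \<theta> \<noteq> \<Phi> \<Longrightarrow> 0 < diff_quot \<Phi> \<theta>"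
  using less_le_trans[OF divide_pos_pos[OF q root_pos]] diff_quot_ge_0[of \<Phi> \<theta>] root_pos
  by (simp add: diff_quot_0)

lemma totally_monotone_inverse_diff_quot:
  assumes "0 \<le> s" "0 < h" and ne: "\<And>k. s + real k * h \<noteq> \<Phi>"
  shows "totally_monotone (\<lambda>k. 1 / diff_quot \<Phi> (s + real k * h))"
  using assms root_pos
  by (intro totally_monotone_inverse totally_monotone_diff_quot_increments diff_quot_pos) auto

text \<open>The transform of the tilted function at \<open>s\<close>, multiplied by
  \<open>s\<close>, is the reciprocal of the difference quotient at \<open>s + \<Phi>\<close>, hence
  totally monotone along the integers.\<close>

lemma exp_W_mono: "mono_on {0..} (\<lambda>x. exp (- \<Phi> * x) * W x)"
proof (rule nondecreasing_of_has_laplace)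
  show "continuous_on {0..} (\<lambda>x. exp (- \<Phi> * x) * W x)"
    by (intro continuous_intros W_continuous)
  show "0 \<le> exp (- \<Phi> * x) * W x" if "0 \<le> x" for x using W_nonneg[OF that] by simp
  show "has_laplace (\<lambda>x. exp (- \<Phi> * x) * W x) s (1 / (\<psi> (s + \<Phi>) - q))" if "0 < s" for s
    using has_laplace_shift[OF W_laplace_root[of "s + \<Phi>"], of "- \<Phi>"] that by simp
  have "(1 + real k) * (1 / (\<psi> (1 + real k + \<Phi>) - q)) = 1 / diff_quot \<Phi> (1 + \<Phi> + real k * 1)" for k
    by (simp add: diff_quot_def psi_root add_ac)
  moreover have "totally_monotone (\<lambda>k. 1 / diff_quot \<Phi> (1 + \<Phi> + real k * 1))"
  proof (rule totally_monotone_inverse_diff_quot)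
    show "1 + \<Phi> + real k * 1 \<noteq> \<Phi>" for k using of_nat_0_le_iff[of k] by linarith
  qed (use root_pos in auto)
  ultimately show "totally_monotone (\<lambda>k. (1 + real k) * (1 / (\<psi> (1 + real k + \<Phi>) - q)))"
    by simp
qed

text \<open>Probabilistically, \<open>H x\<close> is the expectation of \<open>exp (- q \<tau>)\<close>, with \<open>\<tau>\<close> the first passage time
  below 0 of the process started at \<open>x\<close>; \<open>R\<close> is the continuation to \<open>(0,\<infinity>)\<close> of its transform.\<close>

definition H :: "real \<Rightarrow> real" where "H x = Z q W x - q / \<Phi> * W x"

definition R :: "real \<Rightarrow> real" where
  "R \<theta> = (diff_quot \<Phi> \<theta> - diff_quot \<Phi> 0) / \<theta> * (1 / diff_quot \<Phi> \<theta>)"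

lemma Z_continuous: "continuous_on {0..} (Z q W)"
  unfolding Z_def by (intro continuous_intros antiderivative_continuous W_continuous)

lemma H_continuous: "continuous_on {0..} H"
  unfolding H_def by (intro continuous_intros Z_continuous W_continuous)

text \<open>The coefficient \<open>q / \<Phi>\<close> equals \<open>diff_quot \<Phi> 0\<close>; this
  makes the transform factor into a slope and a reciprocal, both totally monotone.\<close>

lemma H_laplace:
  assumes "\<Phi> < \<theta>"
  shows "has_laplace H \<theta> (R \<theta>)"
proof -
  have pos: "0 < \<theta>" "0 < \<psi> \<theta> - q" using assms root_pos psi_gt_root[OF assms] by auto
  \<comment> \<open>An intermediate rate at which the transform of \<open>W\<close> is still
    available.\<close>
  let ?r = "(\<Phi> + \<theta>) / 2"
  have r: "\<Phi> < ?r" "?r < \<theta>" "0 \<le> ?r" using assms root_pos by (auto simp: field_simps)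
  have "has_laplace (\<lambda>x. integral {0..x} W) \<theta> ((1 / (\<psi> \<theta> - q)) / \<theta>)"
    by (rule has_laplace_antiderivative[OF W_continuous W_nonneg W_laplace_root[OF r(1)] r(3,2) W_laplace_root[OF assms]])
  then have "has_laplace H \<theta> (1 / \<theta> + q * ((1 / (\<psi> \<theta> - q)) / \<theta>) - q / \<Phi> * (1 / (\<psi> \<theta> - q)))"
    unfolding H_def[abs_def] Z_def using pos assms
    by (intro has_laplace_diff has_laplace_add has_laplace_1 has_laplace_cmult W_laplace_root)
  moreover have "1 / \<theta> + q * ((1 / (\<psi> \<theta> - q)) / \<theta>) - q / \<Phi> * (1 / (\<psi> \<theta> - q)) = R \<theta>"
  proof -
    have "1 / t + q * ((1 / d) / t) - q / \<Phi> * (1 / d) = (d / (t - \<Phi>) - q / \<Phi>) / t * (1 / (d / (t - \<Phi>)))"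
      if "0 < d" "0 < t" "0 < t - \<Phi>" for d t
    proof -
      have "(d / e - r) / t * (1 / (d / e)) = 1 / t - r * (e / (t * d))" if "0 < e" for e r
        using that \<open>0 < d\<close> \<open>0 < t\<close> by (simp add: field_simps)
      moreover have "1 / t + q * ((1 / d) / t) - q / \<Phi> * (1 / d) = 1 / t - q / \<Phi> * ((t - \<Phi>) / (t * d))"
        using that root_pos by (simp add: field_simps)
      ultimately show ?thesis using that by simp
    qed
    from this[of "\<psi> \<theta> - q" \<theta>] show ?thesis
      using pos assms by (simp only: R_def diff_quot_0) (simp add: diff_quot_def psi_root)
  qed
  ultimately show ?thesis by simp
qed

text \<open>The progression may start to the left of \<open>\<Phi>\<close> and jump over it, where
  \<open>R\<close> is not yet known to be a transform.\<close>

lemma totally_monotone_R: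
  assumes "0 < s" "0 < h" and ne: "\<And>k. s + real k * h \<noteq> \<Phi>"
  shows "totally_monotone (\<lambda>k. R (s + real k * h))"
  unfolding R_def using assms root_pos
  by (intro totally_monotone_mult totally_monotone_diff_quot_slope totally_monotone_inverse_diff_quot) auto

lemma H_nonneg:
  assumes "0 \<le> x"
  shows "0 \<le> H x"
proof (rule nonneg_of_has_laplace[OF H_continuous, of 1 "\<Phi> + 1" "\<lambda>k. R (\<Phi> + 1 + real k * 1)"])
  show "has_laplace H (\<Phi> + 1 + real k * 1) (R (\<Phi> + 1 + real k * 1))" for k
    by (rule H_laplace) (simp add: add_pos_nonneg)
  show "totally_monotone (\<lambda>k. R (\<Phi> + 1 + real k * 1))"
  proof (rule totally_monotone_R)
    show "\<Phi> + 1 + real k * 1 \<noteq> \<Phi>" for k using of_nat_0_le_iff[of k] by linarith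
  qed (use root_pos in auto)
qed (use assms in auto)

lemma Z_diff:
  assumes "0 \<le> x" "x \<le> y"
  shows "Z q W y - Z q W x = q * integral {x..y} W"
proof -
  have "W integrable_on {0..y}"
    by (intro integrable_continuous_real continuous_on_subset[OF W_continuous]) auto
  from Henstock_Kurzweil_Integration.integral_combine[OF assms this]
  show ?thesis unfolding Z_def by (simp add: distrib_left flip: right_diff_distrib)
qed

text \<open>With \<open>W u = exp (\<Phi> * u) * V u\<close> and \<open>V\<close> nondecreasing,
  \<open>\<Phi>\<close> times the integral of \<open>W\<close> over \<open>[x, y]\<close> is at most
  \<open>W y - W x\<close>. This replaces the sign of the derivative of \<open>H\<close> without
  differentiating \<open>W\<close>.\<close>

lemma H_antimono:
  assumes xy: "0 \<le> x" "x \<le> y"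
  shows "H y \<le> H x"
proof -
  define V where "V u = exp (- \<Phi> * u) * W u" for u
  have WV: "W u = exp (\<Phi> * u) * V u" for u by (simp add: V_def exp_minus)
  have Vm: "V u \<le> V v" if "0 \<le> u" "u \<le> v" for u v
    using exp_W_mono that by (auto simp: V_def mono_on_def)
  have I1: "((\<lambda>u. exp (\<Phi> * u) * V y) has_integral (exp (\<Phi> * y) * V y / \<Phi> - exp (\<Phi> * x) * V y / \<Phi>)) {x..y}"
    using xy root_pos by (intro fundamental_theorem_of_calculus)
      (auto intro!: derivative_eq_intros simp flip: has_real_derivative_iff_has_vector_derivative)
  have I2: "(W has_integral integral {x..y} W) {x..y}"
    using xy by (intro integrable_integral integrable_continuous_real continuous_on_subset[OF W_continuous]) auto
  have "integral {x..y} W \<le> exp (\<Phi> * y) * V y / \<Phi> - exp (\<Phi> * x) * V y / \<Phi>"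
    using xy Vm[of _ y] by (intro has_integral_le[OF I2 I1]) (auto simp: WV)
  also have "\<dots> \<le> (W y - W x) / \<Phi>"
    using Vm[OF xy] root_pos unfolding WV[of y] WV[of x]
    by (simp add: diff_divide_distrib divide_right_mono mult_left_mono)
  finally have "q * integral {x..y} W \<le> q * ((W y - W x) / \<Phi>)"
    using q by (intro mult_left_mono) auto
  then show ?thesis using Z_diff[OF xy] unfolding H_def
    by (simp add: diff_divide_distrib right_diff_distrib)
qed

text \<open>The step \<open>\<Phi> + 1\<close> leaves only the first node \<open>\<theta>\<close> to
  the left of \<open>\<Phi>\<close>; all others lie where \<open>R\<close> is the transform of
  \<open>H\<close>.\<close>

lemma H_bound:
  assumes "0 < \<theta>" "\<theta> < \<Phi>" "0 < N"
  shows "H N * (1 - exp (- \<theta> * N)) \<le> 1 - diff_quot \<Phi> 0 / diff_quot \<Phi> \<theta>"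
proof -
  have ne: "\<theta> + real k * (\<Phi> + 1) \<noteq> \<Phi> \<and> (k > 0 \<longrightarrow> \<Phi> < \<theta> + real k * (\<Phi> + 1))" for k
  proof (cases k)
    case (Suc m)
    have "0 \<le> real m * (\<Phi> + 1)" using root_pos by simp
    moreover have "real k * (\<Phi> + 1) = \<Phi> + 1 + real m * (\<Phi> + 1)"
      using Suc by (simp add: algebra_simps)
    ultimately have "\<Phi> < \<theta> + real k * (\<Phi> + 1)" using assms by linarith
    then show ?thesis by simp
  qed (use assms in auto)
  have "H N * (1 - exp (- \<theta> * N)) / \<theta> \<le> R (\<theta> + real 0 * (\<Phi> + 1))"
    using assms root_pos ne
    by (intro laplace_continuation_bound[where h = "\<Phi> + 1" and a = "\<lambda>k. R (\<theta> + real k * (\<Phi> + 1))"]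
        H_continuous H_nonneg H_antimono totally_monotone_R H_laplace)
      (use ne[of "Suc k" for k] in auto)
  then have "H N * (1 - exp (- \<theta> * N)) \<le> R \<theta> * \<theta>"
    using assms by (simp add: divide_le_eq)
  also have "R \<theta> * \<theta> = 1 - diff_quot \<Phi> 0 / diff_quot \<Phi> \<theta>"
    using assms diff_quot_pos[of \<theta>] by (simp add: R_def field_simps)
  finally show ?thesis .
qed

text \<open>As \<open>\<theta>\<close> decreases to 0, the right side of \<open>H_bound\<close>
  tends to 0 by continuity of \<open>\<psi>\<close> at 0.\<close>

lemma H_tendsto_0:
  assumes "0 < e"
  obtains N where "0 < N" "H N < e"
proof -
  have "(\<psi> \<longlongrightarrow> \<psi> 0) (at 0 within {0..})"
    using psi_continuous unfolding continuous_on_def by (metis atLeast_iff order_refl)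
  then have "(\<psi> \<longlongrightarrow> \<psi> 0) (at_right 0)" by (rule tendsto_within_subset) auto
  then have "((\<lambda>\<theta>. 1 - diff_quot \<Phi> 0 / ((\<psi> \<theta> - q) / (\<theta> - \<Phi>))) \<longlongrightarrow> 1 - diff_quot \<Phi> 0 / ((\<psi> 0 - q) / (0 - \<Phi>))) (at_right 0)"
    using root_pos q by (intro tendsto_intros) auto
  then have "((\<lambda>\<theta>. 1 - diff_quot \<Phi> 0 / diff_quot \<Phi> \<theta>) \<longlongrightarrow> 0) (at_right 0)"
    using root_pos q by (simp add: diff_quot_def psi_root)
  then have "\<forall>\<^sub>F \<theta> in at_right 0. 1 - diff_quot \<Phi> 0 / diff_quot \<Phi> \<theta> < e / 2"
    using assms by (intro order_tendstoD(2)) auto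
  moreover have "\<forall>\<^sub>F \<theta> in at_right 0. \<theta> \<in> {0<..<\<Phi>}"
    using root_pos by (rule eventually_at_right_real)
  ultimately have "\<forall>\<^sub>F \<theta> in at_right 0. 1 - diff_quot \<Phi> 0 / diff_quot \<Phi> \<theta> < e / 2 \<and> \<theta> \<in> {0<..<\<Phi>}"
    by (rule eventually_conj)
  then obtain \<theta> where \<theta>: "1 - diff_quot \<Phi> 0 / diff_quot \<Phi> \<theta> < e / 2" "0 < \<theta>" "\<theta> < \<Phi>"
    using eventually_happens'[of "at_right (0::real)"] by (auto simp: trivial_limit_at_right_real)
  \<comment> \<open>Chosen so that the factor \<open>1 - exp (- \<theta> * N)\<close> is exactly one
    half.\<close>
  define N where "N = ln 2 / \<theta>"
  have N: "0 < N" "exp (- \<theta> * N) = 1 / 2" using \<theta> by (simp_all add: N_def exp_minus)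
  have "H N * (1 - exp (- \<theta> * N)) < e / 2" using H_bound[OF \<theta>(2,3) N(1)] \<theta>(1) by (rule le_less_trans)
  then have "H N < e" unfolding N(2) by simp
  with N(1) show ?thesis by (rule that)
qed

text \<open>Monotonicity of the tilted \<open>W\<close> from 1 on gives
  \<open>W x \<ge> exp (\<Phi> * (x - 1)) * W 1\<close>, of which a linear lower bound
  suffices.\<close>

lemma W_at_top:
  obtains K where "1 \<le> K" "\<And>x. K \<le> x \<Longrightarrow> B \<le> W x"
proof (rule that[of "max 1 (1 + B / (\<Phi> * W 1))"])
  fix x assume x: "max 1 (1 + B / (\<Phi> * W 1)) \<le> x"
  have "0 < \<Phi> * W 1" using root_pos W_pos[of 1] by simp
  moreover have "B / (\<Phi> * W 1) \<le> x - 1" using x by simp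
  ultimately have "B \<le> (x - 1) * (\<Phi> * W 1)" by (simp only: pos_divide_le_eq)
  also have "\<dots> = \<Phi> * (x - 1) * W 1" by simp
  also have "\<dots> \<le> exp (\<Phi> * (x - 1)) * W 1"
    using W_pos[of 1] exp_ge_add_one_self[of "\<Phi> * (x - 1)"] by (intro mult_right_mono) linarith+
  also have "\<dots> \<le> W x"
  proof -
    have "exp (- \<Phi> * 1) * W 1 \<le> exp (- \<Phi> * x) * W x"
      using x by (intro mono_onD[OF exp_W_mono]) auto
    then have "exp (\<Phi> * x) * (exp (- \<Phi> * 1) * W 1) \<le> exp (\<Phi> * x) * (exp (- \<Phi> * x) * W x)"
      by (intro mult_left_mono) auto
    then show ?thesis
      by (simp add: right_diff_distrib exp_diff exp_minus field_simps)
  qed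
  finally show "B \<le> W x" .
qed simp

lemma Z_deriv:
  assumes "0 < x"
  shows "(Z q W has_real_derivative q * W x) (at x)"
proof -
  have "((\<lambda>x. integral {0..x} W) has_real_derivative W x) (at x within {0..x+1})"
    using assms by (intro antiderivative_deriv W_continuous) auto
  then have "((\<lambda>x. integral {0..x} W) has_real_derivative W x) (at x)"
    using assms by (simp add: at_within_Icc_at)
  then show ?thesis unfolding Z_def[abs_def]
    by (auto intro!: derivative_eq_intros)
qed

lemma Zbar_deriv:
  assumes "0 < x"
  shows "(Zbar q W has_real_derivative Z q W x) (at x)"
proof -
  have "((\<lambda>x. integral {0..x} (Z q W)) has_real_derivative Z q W x) (at x within {0..x+1})"
    using assms by (intro antiderivative_deriv Z_continuous) auto
  then show ?thesis unfolding Zbar_def[abs_def] using assms by (simp add: at_within_Icc_at)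
qed

lemma Zbar_continuous: "continuous_on {0..} (Zbar q W)"
  unfolding Zbar_def by (intro antiderivative_continuous Z_continuous)

lemma Z_less:
  assumes "0 \<le> x" "x < y"
  shows "Z q W x < Z q W y"
proof (rule DERIV_pos_imp_increasing_open[OF assms(2)])
  show "\<exists>d. (Z q W has_real_derivative d) (at z) \<and> 0 < d" if "x < z" "z < y" for z
    using Z_deriv[of z] W_pos[of z] q assms that by (intro exI[of _ "q * W z"]) auto
  show "continuous_on {x..y} (Z q W)"
    using assms by (intro continuous_on_subset[OF Z_continuous]) auto
qed

text \<open>\<open>Z / W\<close> is \<open>H / W\<close> plus a constant, and \<open>H\<close>
  decreases while \<open>W\<close> increases. Cross-multiplication allows
  \<open>W 0 = 0\<close>.\<close>

lemma Z_W_cross: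
  assumes "0 \<le> x" "x \<le> y"
  shows "Z q W y * W x \<le> Z q W x * W y"
proof -
  have "W x \<le> W y" using W_less[of x y] assms by (cases "x = y") auto
  then have "H y * W x \<le> H x * W y"
    using H_antimono[OF assms] H_nonneg[of x] W_nonneg[of x] assms by (intro mult_mono) auto
  then show ?thesis unfolding H_def by (simp add: algebra_simps)
qed

section \<open>Maximization of \<open>xi\<close> by a multiplier\<close>

definition lagrangian :: "real \<Rightarrow> real \<Rightarrow> real \<Rightarrow> real" where
  "lagrangian \<phi> m z = z - \<phi> * Zbar q W z - m * Z q W z"

lemma xi_quotient:
  "xi q c \<phi> W z1 z2 = (z2 - z1 - c - \<phi> * (Zbar q W z2 - Zbar q W z1)) / (Z q W z2 - Z q W z1)"
  by (simp add: xi_def right_diff_distrib diff_divide_distrib)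

lemma xi_ge_iff:
  assumes "0 \<le> z1" "z1 < z2"
  shows "m \<le> xi q c \<phi> W z1 z2 \<longleftrightarrow> c \<le> lagrangian \<phi> m z2 - lagrangian \<phi> m z1"
proof -
  have D: "0 < Z q W z2 - Z q W z1" using Z_less[OF assms] by simp
  show ?thesis unfolding xi_quotient using D by (simp add: le_divide_eq lagrangian_def algebra_simps)
qed

lemma xi_eq_iff:
  assumes "0 \<le> z1" "z1 < z2"
  shows "m = xi q c \<phi> W z1 z2 \<longleftrightarrow> c = lagrangian \<phi> m z2 - lagrangian \<phi> m z1"
proof -
  have D: "0 < Z q W z2 - Z q W z1" using Z_less[OF assms] by simp
  show ?thesis unfolding xi_quotient using D by (auto simp add: eq_divide_eq lagrangian_def algebra_simps)
qed

lemma lagrangian_deriv: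
  assumes "0 < z"
  shows "(lagrangian \<phi> m has_real_derivative 1 - \<phi> * Z q W z - m * (q * W z)) (at z)"
  unfolding lagrangian_def[abs_def]
  by (rule derivative_eq_intros Zbar_deriv Z_deriv assms refl | simp)+

lemma lagrangian_mvt:
  assumes "0 \<le> a" "a < b"
  obtains z where "a < z" "z < b"
    "lagrangian \<phi> m b - lagrangian \<phi> m a = (b - a) * (1 - \<phi> * Z q W z - m * (q * W z))"
proof -
  have "continuous_on {0..} (lagrangian \<phi> m)"
    unfolding lagrangian_def by (intro continuous_intros Zbar_continuous Z_continuous)
  then have "continuous_on {a..b} (lagrangian \<phi> m)"
    using assms by (rule_tac continuous_on_subset) auto
  moreover have "lagrangian \<phi> m differentiable (at z)" if "0 < z" for z
    using lagrangian_deriv[OF that, of \<phi> m] by (auto simp: real_differentiable_def)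
  ultimately have "\<exists>l z. a < z \<and> z < b \<and> (lagrangian \<phi> m has_real_derivative l) (at z) \<and>
      lagrangian \<phi> m b - lagrangian \<phi> m a = (b - a) * l"
    using assms by (intro MVT) auto
  then obtain l z where z: "a < z" "z < b" "(lagrangian \<phi> m has_real_derivative l) (at z)"
      "lagrangian \<phi> m b - lagrangian \<phi> m a = (b - a) * l"
    by blast
  have "l = 1 - \<phi> * Z q W z - m * (q * W z)"
    using z assms lagrangian_deriv by (intro DERIV_unique[OF z(3)]) auto
  then show ?thesis using that z by blast
qed

text \<open>Separates the vanishing part \<open>H\<close> from the growing part \<open>W\<close>;
  the coefficient of \<open>W\<close> changes sign at \<open>m = - \<phi> / \<Phi>\<close>.\<close>

lemma lagrangian_deriv_H:
  "1 - \<phi> * Z q W z - m * (q * W z) = 1 - \<phi> * H z - (m + \<phi> / \<Phi>) * (q * W z)"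
  unfolding H_def using root_pos by (simp add: field_simps)

text \<open>At \<open>m = - \<phi> / \<Phi>\<close> the derivative of the Lagrangian is
  \<open>1 - \<phi> * H z\<close>, which tends to 1, so its increments from 0 eventually exceed
  \<open>c\<close>.\<close>

lemma xi_exceeds_limit:
  assumes "1 < \<phi>" "0 < c"
  obtains z where "c \<le> z" "- \<phi> / \<Phi> < xi q c \<phi> W 0 z"
proof -
  let ?g = "lagrangian \<phi> (- \<phi> / \<Phi>)"
  obtain N where N: "0 < N" "H N < 1 / (2 * \<phi>)"
    using H_tendsto_0[of "1 / (2 * \<phi>)"] assms by auto
  define d where "d = \<bar>?g N - ?g 0\<bar>"
  \<comment> \<open>Slope at least one half over length \<open>T\<close> gains
    \<open>c + d + 1\<close>, more than \<open>c\<close> plus the possible loss \<open>d\<close> on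
    \<open>[0, N]\<close>.\<close>
  define T where "T = 2 * (c + d) + 2"
  have "0 \<le> d" by (simp add: d_def)
  then have T: "0 < T" "c \<le> T" using assms by (simp_all add: T_def)
  obtain z where z: "N < z" "z < N + T"
    "?g (N + T) - ?g N = (N + T - N) * (1 - \<phi> * Z q W z - (- \<phi> / \<Phi>) * (q * W z))"
    using lagrangian_mvt[of N "N + T" \<phi> "- \<phi> / \<Phi>"] N T by auto
  have "H z \<le> 1 / (2 * \<phi>)" using H_antimono[of N z] N z by simp
  then have "\<phi> * H z \<le> \<phi> * (1 / (2 * \<phi>))" using assms by (intro mult_left_mono) auto
  also have "\<dots> = 1 / 2" using assms by simp
  finally have "1 / 2 \<le> 1 - \<phi> * Z q W z - (- \<phi> / \<Phi>) * (q * W z)"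
    unfolding lagrangian_deriv_H by simp
  then have "T * (1 / 2) \<le> ?g (N + T) - ?g N"
    unfolding z(3) using T by (simp only: add_diff_cancel_left') (intro mult_left_mono, auto)
  then have *: "c < ?g (N + T) - ?g 0" by (simp add: T_def d_def abs_if split: if_splits)
  have "- \<phi> / \<Phi> \<le> xi q c \<phi> W 0 (N + T)"
    using * N T by (subst xi_ge_iff) auto
  moreover have "- \<phi> / \<Phi> \<noteq> xi q c \<phi> W 0 (N + T)"
    using * N T by (subst xi_eq_iff) auto
  ultimately show ?thesis using that[of "N + T"] N T by simp
qed

text \<open>Above the limit value the Lagrangian has slope at most 1 everywhere and at most -1
  beyond some \<open>K\<close>. An increment of at least \<open>c\<close> then needs
  \<open>z1 < K\<close>, and the descent after \<open>K\<close> cannot outweigh the rise before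
  it.\<close>

lemma xi_superlevel_bounded:
  assumes "1 < \<phi>" "0 < c" "- \<phi> / \<Phi> < m"
  obtains B where "\<And>z1 z2. 0 \<le> z1 \<Longrightarrow> z1 + c \<le> z2 \<Longrightarrow> m \<le> xi q c \<phi> W z1 z2 \<Longrightarrow> z2 \<le> B"
proof -
  let ?g = "lagrangian \<phi> m"
  have m: "0 < (m + \<phi> / \<Phi>) * q" using assms q by simp
  \<comment> \<open>The threshold makes the \<open>W\<close> term of the derivative at least 2,
    leaving a slope of at most -1.\<close>
  obtain K where K: "1 \<le> K" "\<And>x. K \<le> x \<Longrightarrow> 2 / ((m + \<phi> / \<Phi>) * q) \<le> W x"
    using W_at_top[of "2 / ((m + \<phi> / \<Phi>) * q)"] by blast
  have le1: "?g b - ?g a \<le> b - a" if ab: "0 \<le> a" "a \<le> b" for a b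
  proof (cases "a = b")
    case False
    then obtain z where z: "a < z" "?g b - ?g a = (b - a) * (1 - \<phi> * Z q W z - m * (q * W z))"
      using lagrangian_mvt[of a b \<phi> m] ab by auto
    have "1 - \<phi> * H z - (m + \<phi> / \<Phi>) * (q * W z) \<le> 1"
    proof -
      have "0 \<le> \<phi> * H z" using H_nonneg[of z] z ab assms by simp
      moreover have "0 \<le> (m + \<phi> / \<Phi>) * q * W z"
        using W_nonneg[of z] z ab m by (simp del: mult_nonneg_nonneg add: less_imp_le mult_nonneg_nonneg[of "(m + \<phi> / \<Phi>) * q"])
      ultimately show ?thesis by (simp add: mult.assoc)
    qed
    then have "(b - a) * (1 - \<phi> * H z - (m + \<phi> / \<Phi>) * (q * W z)) \<le> (b - a) * 1"
      using ab by (intro mult_left_mono) auto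
    then show ?thesis unfolding z(2) lagrangian_deriv_H by simp
  qed simp
  have leK: "?g b - ?g a \<le> - (b - a)" if ab: "K \<le> a" "a \<le> b" for a b
  proof (cases "a = b")
    case False
    then obtain z where z: "a < z" "?g b - ?g a = (b - a) * (1 - \<phi> * Z q W z - m * (q * W z))"
      using lagrangian_mvt[of a b \<phi> m] ab K by auto
    have W2: "2 \<le> (m + \<phi> / \<Phi>) * q * W z"
      using K(2)[of z] z ab m by (simp add: divide_le_eq mult.commute)
    have "1 - \<phi> * H z - (m + \<phi> / \<Phi>) * (q * W z) \<le> - 1"
    proof -
      have "0 \<le> \<phi> * H z" using H_nonneg[of z] z ab K assms by simp
      then show ?thesis using W2 by (simp add: mult.assoc)
    qed
    then have "(b - a) * (1 - \<phi> * H z - (m + \<phi> / \<Phi>) * (q * W z)) \<le> (b - a) * (- 1)"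
      using ab by (intro mult_left_mono) auto
    then show ?thesis unfolding z(2) lagrangian_deriv_H by simp
  qed simp
  show ?thesis
  proof (rule that[of "2 * K"])
    fix z1 z2 assume z: "0 \<le> z1" "z1 + c \<le> z2" "m \<le> xi q c \<phi> W z1 z2"
    then have c: "c \<le> ?g z2 - ?g z1" using assms by (subst (asm) xi_ge_iff) auto
    show "z2 \<le> 2 * K"
    proof (rule ccontr)
      assume "\<not> z2 \<le> 2 * K"
      moreover have "z1 < K" using leK[of z1 z2] c z assms by (cases "K \<le> z1") auto
      ultimately show False using leK[of K z2] le1[of z1 K] c z assms K by simp
    qed
  qed
qed

lemma xi_attains_maximum:
  assumes "1 < \<phi>" "0 < c"
  shows "xi_maximizers q c \<phi> W \<noteq> {}"
proof -
  let ?x = "\<lambda>p. xi q c \<phi> W (fst p) (snd p)"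
  obtain z0 where z0: "c \<le> z0" "- \<phi> / \<Phi> < xi q c \<phi> W 0 z0"
    using xi_exceeds_limit[OF assms] by blast
  from xi_superlevel_bounded[OF assms z0(2)] obtain B where
    B: "\<And>z1 z2. 0 \<le> z1 \<Longrightarrow> z1 + c \<le> z2 \<Longrightarrow> xi q c \<phi> W 0 z0 \<le> xi q c \<phi> W z1 z2 \<Longrightarrow> z2 \<le> B"
    by blast
  \<comment> \<open>A compact part of the domain containing every point whose value is at least that
    of \<open>(0, z0)\<close>; points outside \<open>C\<close> cannot compete.\<close>
  define C where "C = {p :: real \<times> real. 0 \<le> fst p \<and> fst p + c \<le> snd p \<and> snd p \<le> B}"
  have "closed C"
    unfolding C_def by (intro closed_Collect_conj closed_Collect_le continuous_intros)
  moreover have "C \<subseteq> {0..B} \<times> {0..B}" using assms by (auto simp: C_def)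
  then have "bounded C" by (rule bounded_subset[rotated]) (intro bounded_Times bounded_closed_interval)
  ultimately have "compact C" by (simp add: compact_eq_bounded_closed)
  moreover have z0C: "(0, z0) \<in> C" using z0 B[of 0 z0] by (simp add: C_def)
  then have "C \<noteq> {}" by blast
  moreover have "continuous_on C ?x"
  proof -
    have "fst ` C \<subseteq> {0..}" "snd ` C \<subseteq> {0..}" using assms by (auto simp: C_def)
    then have "continuous_on C (\<lambda>p. Z q W (fst p))" "continuous_on C (\<lambda>p. Z q W (snd p))"
      "continuous_on C (\<lambda>p. Zbar q W (fst p))" "continuous_on C (\<lambda>p. Zbar q W (snd p))"
      by (auto intro!: continuous_on_compose2[OF Z_continuous] continuous_on_compose2[OF Zbar_continuous] continuous_intros)
    moreover have "Z q W (snd p) - Z q W (fst p) \<noteq> 0" if "p \<in> C" for p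
      using Z_less[of "fst p" "snd p"] that assms by (auto simp: C_def)
    ultimately show ?thesis unfolding xi_def by (intro continuous_intros) auto
  qed
  ultimately obtain p where p: "p \<in> C" "\<And>r. r \<in> C \<Longrightarrow> ?x r \<le> ?x p"
    using continuous_attains_sup[of C ?x] by blast
  have "is_arg_max (\<lambda>(z1, z2). xi q c \<phi> W z1 z2) (\<lambda>z. z \<in> xi_domain c) p"
    unfolding is_arg_max_linorder
  proof (intro conjI allI impI)
    show "p \<in> xi_domain c" using p(1) by (auto simp: C_def xi_domain_def)
    fix r assume r: "r \<in> xi_domain c"
    have "?x r \<le> ?x p"
    proof (cases "r \<in> C")
      case False
      then have "\<not> xi q c \<phi> W 0 z0 \<le> ?x r"
        using r B[of "fst r" "snd r"] by (auto simp: C_def xi_domain_def)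
      then show ?thesis using p(2)[OF z0C] by simp
    qed (rule p)
    then show "(case r of (z1, z2) \<Rightarrow> xi q c \<phi> W z1 z2) \<le> (case p of (z1, z2) \<Rightarrow> xi q c \<phi> W z1 z2)"
      by (simp add: case_prod_beta)
  qed
  then show ?thesis unfolding xi_maximizers_def by blast
qed

text \<open>Only \<open>z2\<close> is varied. Off the boundary \<open>z2 = z1 + c\<close> it is an
  interior maximum of the Lagrangian; on it, the monotonicity of \<open>Z / W\<close> gives a
  contradiction.\<close>

lemma xi_maximizer_first_order:
  assumes "1 < \<phi>" "0 < c" and max: "(z1, z2) \<in> xi_maximizers q c \<phi> W"
  shows "xi q c \<phi> W z1 z2 = (1 - \<phi> * Z q W z2) / (q * W z2)"
proof -
  define m where "m = xi q c \<phi> W z1 z2"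
  let ?g = "lagrangian \<phi> m" and ?d = "\<lambda>z. 1 - \<phi> * Z q W z - m * (q * W z)"
  have dom: "0 \<le> z1" "z1 + c \<le> z2"
    using max by (auto simp: xi_maximizers_def is_arg_max_def xi_domain_def)
  have le: "xi q c \<phi> W z1 z \<le> m" if "z1 + c \<le> z" for z
    using max that dom unfolding m_def
    by (auto simp: xi_maximizers_def is_arg_max_linorder xi_domain_def)
  have c: "c = ?g z2 - ?g z1"
    using xi_eq_iff[of z1 z2 m c \<phi>] dom assms by (simp add: m_def)
  have gmax: "?g z \<le> ?g z2" if "z1 + c \<le> z" for z
  proof (rule ccontr)
    assume "\<not> ?g z \<le> ?g z2"
    then have less: "c < ?g z - ?g z1" using c by simp
    then have "m \<le> xi q c \<phi> W z1 z" using dom that assms by (subst xi_ge_iff) auto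
    with le[OF that] have "m = xi q c \<phi> W z1 z" by simp
    then have "c = ?g z - ?g z1" using dom that assms by (subst (asm) xi_eq_iff) auto
    with less show False by simp
  qed
  have z2: "0 < z2" using dom assms by simp
  note deriv = lagrangian_deriv[OF z2, of \<phi> m]
  have "?d z2 = 0"
  proof (cases "z2 = z1 + c")
    case False
    show ?thesis
    proof (rule DERIV_local_max[OF deriv, of "z2 - (z1 + c)"])
      show "\<forall>y. \<bar>z2 - y\<bar> < z2 - (z1 + c) \<longrightarrow> ?g y \<le> ?g z2" using gmax by auto
    qed (use False dom in auto)
  next
    case True
    txt \<open>At the corner the mean value theorem contradicts \<open>g\<^sub>m z\<^sub>2 - g\<^sub>m z\<^sub>1 = c = z\<^sub>2 - z\<^sub>1\<close>.\<close>
    have d: "?d z2 \<le> 0"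
    proof (rule ccontr)
      assume "\<not> ?d z2 \<le> 0"
      then obtain e where "0 < e" "\<And>h. 0 < h \<Longrightarrow> h < e \<Longrightarrow> ?g z2 < ?g (z2 + h)"
        using DERIV_pos_inc_right[OF deriv] by auto
      then have "?g z2 < ?g (z2 + e / 2)" by simp
      then show False using gmax[of "z2 + e / 2"] True \<open>0 < e\<close> by simp
    qed
    obtain z where z: "z1 < z" "z < z2" "?g z2 - ?g z1 = (z2 - z1) * ?d z"
      using lagrangian_mvt[of z1 z2 \<phi> m] dom True assms by auto
    have W: "0 < W z" "0 < W z2" using z dom W_pos by auto
    \<comment> \<open>The sign of the derivative at \<open>z2\<close> is carried back to
      \<open>z\<close> by \<open>Z_W_cross\<close>; dropping \<open>W z > 0\<close> makes the
      inequality strict.\<close>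
    have "W z * (- (m * q) * W z2) \<le> W z * (\<phi> * Z q W z2 - 1)"
      using d W by (intro mult_left_mono) (auto simp: mult_ac)
    also have "\<dots> < \<phi> * (Z q W z2 * W z)" using W by (simp add: algebra_simps)
    also have "\<dots> \<le> \<phi> * (Z q W z * W z2)"
      using Z_W_cross[of z z2] z dom assms by (intro mult_left_mono) auto
    finally have "0 < (\<phi> * Z q W z + m * (q * W z)) * W z2" by (simp add: algebra_simps)
    then have "?d z < 1" using W by (simp add: zero_less_mult_iff)
    then have "(z2 - z1) * ?d z < (z2 - z1) * 1"
      using z by (intro mult_strict_left_mono) auto
    then have "?g z2 - ?g z1 < z2 - z1" unfolding z(3) by simp
    then have False using c True by linarith
    then show ?thesis ..
  qed
  then have "m * (q * W z2) = 1 - \<phi> * Z q W z2" by simp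
  moreover have "q * W z2 \<noteq> 0" using W_pos[OF z2] q by simp
  ultimately show ?thesis unfolding m_def by (simp add: eq_divide_eq)
qed

end

theorem proposition3p3:
  fixes M :: "'a measure" and X :: "real \<Rightarrow> 'a \<Rightarrow> real"
    and \<gamma> \<sigma> q c \<phi> :: real and \<upsilon> :: "real measure" and W :: "real \<Rightarrow> real"
  assumes "spectrally_negative_levy M X"
    and "has_levy_triplet M X \<gamma> \<sigma> \<upsilon>"
    and "finite_deriv_at_0 (laplace_exponent M X)"
    and "q > 0" and "c > 0" and "\<phi> > 1"
    and "scale_function (laplace_exponent M X) q W"
  shows "xi_maximizers q c \<phi> W \<noteq> {} \<and>
    (\<forall>(z1, z2) \<in> xi_maximizers q c \<phi> W.
       (z2 - z1 - c) / (Z q W z2 - Z q W z1)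
       - \<phi> * ((Zbar q W z2 - Zbar q W z1) / (Z q W z2 - Z q W z1))
       = (1 - \<phi> * Z q W z2) / (q * W z2))"
proof -
  interpret scale_function_setting "laplace_exponent M X" \<gamma> \<sigma> \<upsilon> q W
    by unfold_locales (use assms in \<open>auto simp: has_levy_triplet_def\<close>)
  show ?thesis
    using xi_attains_maximum xi_maximizer_first_order assms by (auto simp: xi_def)
qed

end
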